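(* Let $\mathcal{H}$ be a complex Hilbert space with inner product $\langle\cdot|\cdot\rangle$, $\mathcal{D}$ a dense subspace of $\mathcal{H}$, and $\Omega$ a sesquilinear form on $\mathcal{D}$ which is solvable with respect to a norm $\|\cdot\|_\Omega$ on $\mathcal{D}$. Then there exists a closed operator $T$ in $\mathcal{H}$, with domain $D(T)\subseteq\mathcal{D}$ dense in $\mathcal{H}$, such that $$\Omega(\xi,\eta)=\langle T\xi|\eta\rangle\qquad\forall \xi\in D(T),\ \eta\in\mathcal{D}. \qquad ( * )$$ Moreover: 1. $D(T)$ is dense in $\mathcal{D}[\|\cdot\|_\Omega]$; 2. if $T'$ is an operator in $\mathcal{H}$ with domain $D(T')\subseteq\mathcal{D}$ and $\Omega(\xi,\eta)=\langle T'\xi|\eta\rangle$ for all $\xi\in D(T')$ and all $\eta$ belonging to a dense subset of $\mathcal{D}[\|\cdot\|_\Omega]$, then $T'\subseteq T$ (i.e. $T$ extends $T'$); 3. if $\Upsilon\in\mathfrak{P}(\Omega)$ and $B\in\mathcal{B}(\mathcal{H})$ is the bounded operator such that $\Upsilon(\xi,\eta)=\langle B\xi|\eta\rangle$ for all $\xi,\eta\in\mathcal{H}$, then $T+B$ is invertible and $(T+B)^{-1}\in\mathcal{B}(\mathcal{H})$. In particular, if $\Upsilon=-\lambda\iota$ with $\lambda\in\mathbb{C}$, then $\lambda\in\rho(T)$, the resolvent set of $T$; 4. with $\Upsilon\in\mathfrak{P}(\Omega)$ and $B$ as in item 3, $T$ is the unique operator (with domain contained in $\mathcal{D}$) satisfying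 $( * )$ with the property that $T+B$ has range $\mathcal{H}$.
   Context: Let $\|\cdot\|$ be the norm of $\mathcal{H}$; $\mathcal{B}(\mathcal{H})$ is the space of bounded everywhere-defined operators on $\mathcal{H}$; $\iota$ denotes the form $\iota(\xi,\eta)=\langle\xi|\eta\rangle$; operators are linear; $\mathcal{D}[\|\cdot\|_\Omega]$ denotes $\mathcal{D}$ endowed with the norm $\|\cdot\|_\Omega$. Sesquilinear forms are linear in the first variable and conjugate linear in the second. A sesquilinear form $\Omega$ on the dense subspace $\mathcal{D}$ is q-closed with respect to a norm $\|\cdot\|_\Omega$ on $\mathcal{D}$ if: (1) there is $\alpha>0$ with $\|\xi\|\le\alpha\|\xi\|_\Omega$ for all $\xi\in\mathcal{D}$; (2) if $\{\xi_n\}\subset\mathcal{D}$, $\|\xi_n\|\to0$ and $\|\xi_n-\xi_m\|_\Omega\to0$, then $\|\xi_n\|_\Omega\to0$; (3) $\mathcal{E}_\Omega:=\mathcal{D}[\|\cdot\|_\Omega]$ is a reflexive Banach space; (4) there is $\beta>0$ with $|\Omega(\xi,\eta)|\le\beta\|\xi\|_\Omega\|\eta\|_\Omega$ for all $\xi,\eta\in\mathcal{D}$. Let $\mathcal{E}_\Omega^\times$ be the conjugate dual of $\mathcal{E}_\Omega$ (bounded conjugate linear functionals). For $\Omega$ q-closed with respect to $\|\cdot\|_\Omega$, $\mathfrak{P}(\Omega)$ is the set of bounded sesquilinear forms $\Upsilon$ on $\mathcal{H}$ such that (i) if $\xi\in\mathcal{D}$ and $(\Omega+\Upsilon)(\xi,\eta)=0$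 for all $\eta\in\mathcal{D}$, then $\xi=0$; (ii) for every $\Lambda\in\mathcal{E}_\Omega^\times$ there is $\xi\in\mathcal{D}$ with $\Lambda(\eta)=(\Omega+\Upsilon)(\xi,\eta)$ for all $\eta\in\mathcal{D}$. $\Omega$ is solvable with respect to $\|\cdot\|_\Omega$ if it is q-closed with respect to $\|\cdot\|_\Omega$ and $\mathfrak{P}(\Omega)\neq\varnothing$. *)

theory Defs
  imports "HOL-Analysis.Analysis"
begin

section \<open>Complex Hilbert spaces\<close>

class complex_vector = real_vector +
  fixes scaleC :: "complex \<Rightarrow> 'a \<Rightarrow> 'a"  (infixr \<open>*\<^sub>C\<close> 75)
  assumes scaleC_add_right: "a *\<^sub>C (x + y) = a *\<^sub>C x + a *\<^sub>C y"
    and scaleC_add_left: "(a + b) *\<^sub>C x = a *\<^sub>C x + b *\<^sub>C x"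
    and scaleC_scaleC: "a *\<^sub>C b *\<^sub>C x = (a * b) *\<^sub>C x"
    and scaleC_one: "1 *\<^sub>C x = x"
    and scaleR_scaleC: "r *\<^sub>R x = complex_of_real r *\<^sub>C x"

global_interpretation complex_vector:
  vector_space "scaleC :: complex \<Rightarrow> 'a \<Rightarrow> 'a::complex_vector"
  by unfold_locales
     (simp_all add: scaleC_add_right scaleC_add_left scaleC_scaleC scaleC_one)

abbreviation csubspace :: "'a::complex_vector set \<Rightarrow> bool" where
  "csubspace \<equiv> module.subspace scaleC"

text \<open>The inner product is linear in the first argument.\<close>

class complex_inner = complex_vector + real_normed_vector +
  fixes cinner :: "'a \<Rightarrow> 'a \<Rightarrow> complex"
  assumes cinner_add_left: "cinner (x + y) z = cinner x z + cinner y z"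
    and cinner_scaleC_left: "cinner (c *\<^sub>C x) y = c * cinner x y"
    and cinner_commute: "cinner x y = cnj (cinner y x)"
    and cinner_ge_zero: "0 \<le> Re (cinner x x)"
    and cinner_eq_zero_iff: "cinner x x = 0 \<longleftrightarrow> x = 0"
    and norm_eq_sqrt_cinner: "norm x = sqrt (Re (cinner x x))"

class complex_hilbert = complex_inner + complete_space

section \<open>A norm on a subspace, duals and reflexivity\<close>

definition norm_on :: "'a::complex_vector set \<Rightarrow> ('a \<Rightarrow> real) \<Rightarrow> bool" where
  "norm_on V N \<longleftrightarrow>
     (\<forall>x\<in>V. 0 \<le> N x) \<and>
     (\<forall>x\<in>V. N x = 0 \<longleftrightarrow> x = 0) \<and>
     (\<forall>c. \<forall>x\<in>V. N (c *\<^sub>C x) = cmod c * N x) \<and>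
     (\<forall>x\<in>V. \<forall>y\<in>V. N (x + y) \<le> N x + N y)"

text \<open>The locale \<^locale>\<open>Metric_space\<close> asks for symmetry and nonnegativity on the whole
  type, hence the value 0 outside \<open>V\<close>.\<close>

definition norm_dist :: "'a::complex_vector set \<Rightarrow> ('a \<Rightarrow> real) \<Rightarrow> 'a \<Rightarrow> 'a \<Rightarrow> real" where
  "norm_dist V N x y = (if x \<in> V \<and> y \<in> V then N (x - y) else 0)"

lemma Metric_space_norm_dist:
  assumes V: "csubspace V" and N: "norm_on V N"
  shows "Metric_space V (norm_dist V N)"
proof
  have minus: "N (x - y) = N (y - x)" if "x \<in> V" "y \<in> V" for x y
  proof -
    have "y - x \<in> V" using that V by (simp add: complex_vector.subspace_diff)
    then have "N ((- 1) *\<^sub>C (y - x)) = cmod (- 1) * N (y - x)"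
      using N unfolding norm_on_def by blast
    then show ?thesis by simp
  qed
  show "0 \<le> norm_dist V N x y" for x y
    using N V by (simp add: norm_dist_def norm_on_def complex_vector.subspace_diff)
  show "norm_dist V N x y = norm_dist V N y x" for x y
    by (simp add: norm_dist_def minus)
  show "norm_dist V N x y = 0 \<longleftrightarrow> x = y" if "x \<in> V" "y \<in> V" for x y
    using that N V by (simp add: norm_dist_def norm_on_def complex_vector.subspace_diff)
  show "norm_dist V N x z \<le> norm_dist V N x y + norm_dist V N y z"
    if "x \<in> V" "y \<in> V" "z \<in> V" for x y z
  proof -
    have "x - y \<in> V" "y - z \<in> V"
      using that V by (simp_all add: complex_vector.subspace_diff)
    then have "N ((x - y) + (y - z)) \<le> N (x - y) + N (y - z)"
      using N unfolding norm_on_def by blast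
    then show ?thesis using that by (simp add: norm_dist_def)
  qed
qed

definition dense_wrt :: "'a::complex_vector set \<Rightarrow> ('a \<Rightarrow> real) \<Rightarrow> 'a set \<Rightarrow> bool" where
  "dense_wrt V N S \<longleftrightarrow>
     S \<subseteq> V \<and> Metric_space.mtopology V (norm_dist V N) closure_of S = V"

text \<open>Functionals on \<open>V\<close> are represented by functions vanishing off \<open>V\<close>, so that distinct
  elements of the dual are distinct functionals.\<close>

definition dual :: "'a::complex_vector set \<Rightarrow> ('a \<Rightarrow> real) \<Rightarrow> ('a \<Rightarrow> complex) set" where
  "dual V N = {f. (\<forall>x\<in>V. \<forall>y\<in>V. f (x + y) = f x + f y) \<and>
                  (\<forall>c. \<forall>x\<in>V. f (c *\<^sub>C x) = c * f x) \<and>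
                  (\<exists>K. \<forall>x\<in>V. cmod (f x) \<le> K * N x) \<and>
                  (\<forall>x. x \<notin> V \<longrightarrow> f x = 0)}"

definition conj_dual :: "'a::complex_vector set \<Rightarrow> ('a \<Rightarrow> real) \<Rightarrow> ('a \<Rightarrow> complex) set" where
  "conj_dual V N = {f. (\<forall>x\<in>V. \<forall>y\<in>V. f (x + y) = f x + f y) \<and>
                       (\<forall>c. \<forall>x\<in>V. f (c *\<^sub>C x) = cnj c * f x) \<and>
                       (\<exists>K. \<forall>x\<in>V. cmod (f x) \<le> K * N x) \<and>
                       (\<forall>x. x \<notin> V \<longrightarrow> f x = 0)}"

definition dual_norm :: "'a::complex_vector set \<Rightarrow> ('a \<Rightarrow> real) \<Rightarrow> ('a \<Rightarrow> complex) \<Rightarrow> real" where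
  "dual_norm V N f = (SUP x\<in>{x \<in> V. N x \<le> 1}. cmod (f x))"

text \<open>Elements of the bidual are only ever evaluated on \<^term>\<open>dual V N\<close>; their values elsewhere
  are irrelevant.\<close>

definition bidual ::
  "'a::complex_vector set \<Rightarrow> ('a \<Rightarrow> real) \<Rightarrow> (('a \<Rightarrow> complex) \<Rightarrow> complex) set" where
  "bidual V N =
     {F. (\<forall>f\<in>dual V N. \<forall>g\<in>dual V N. F (\<lambda>x. f x + g x) = F f + F g) \<and>
         (\<forall>c. \<forall>f\<in>dual V N. F (\<lambda>x. c * f x) = c * F f) \<and>
         (\<exists>K. \<forall>f\<in>dual V N. cmod (F f) \<le> K * dual_norm V N f)}"

definition reflexive_wrt :: "'a::complex_vector set \<Rightarrow> ('a \<Rightarrow> real) \<Rightarrow> bool" where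
  "reflexive_wrt V N \<longleftrightarrow> (\<forall>F\<in>bidual V N. \<exists>x\<in>V. \<forall>f\<in>dual V N. F f = f x)"

section \<open>Solvable sesquilinear forms\<close>

definition sesquilinear_on ::
  "'a::complex_vector set \<Rightarrow> ('a \<Rightarrow> 'a \<Rightarrow> complex) \<Rightarrow> bool" where
  "sesquilinear_on D \<Omega> \<longleftrightarrow>
     (\<forall>x\<in>D. \<forall>y\<in>D. \<forall>z\<in>D. \<Omega> (x + y) z = \<Omega> x z + \<Omega> y z) \<and>
     (\<forall>x\<in>D. \<forall>y\<in>D. \<forall>z\<in>D. \<Omega> x (y + z) = \<Omega> x y + \<Omega> x z) \<and>
     (\<forall>c. \<forall>x\<in>D. \<forall>y\<in>D. \<Omega> (c *\<^sub>C x) y = c * \<Omega> x y) \<and>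
     (\<forall>c. \<forall>x\<in>D. \<forall>y\<in>D. \<Omega> x (c *\<^sub>C y) = cnj c * \<Omega> x y)"

definition bounded_form :: "('a::complex_hilbert \<Rightarrow> 'a \<Rightarrow> complex) \<Rightarrow> bool" where
  "bounded_form \<Upsilon> \<longleftrightarrow>
     sesquilinear_on UNIV \<Upsilon> \<and> (\<exists>K. \<forall>x y. cmod (\<Upsilon> x y) \<le> K * norm x * norm y)"

definition q_closed ::
  "'a::complex_hilbert set \<Rightarrow> ('a \<Rightarrow> 'a \<Rightarrow> complex) \<Rightarrow> ('a \<Rightarrow> real) \<Rightarrow> bool" where
  "q_closed D \<Omega> N \<longleftrightarrow>
     (\<exists>\<alpha>>0. \<forall>\<xi>\<in>D. norm \<xi> \<le> \<alpha> * N \<xi>) \<and>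
     (\<forall>\<xi>. range \<xi> \<subseteq> D \<and> (\<lambda>n. norm (\<xi> n)) \<longlonglongrightarrow> 0 \<and>
          Metric_space.MCauchy D (norm_dist D N) \<xi> \<longrightarrow> (\<lambda>n. N (\<xi> n)) \<longlonglongrightarrow> 0) \<and>
     (Metric_space.mcomplete D (norm_dist D N) \<and> reflexive_wrt D N) \<and>
     (\<exists>\<beta>>0. \<forall>\<xi>\<in>D. \<forall>\<eta>\<in>D. cmod (\<Omega> \<xi> \<eta>) \<le> \<beta> * N \<xi> * N \<eta>)"

definition solving_forms ::
  "'a::complex_hilbert set \<Rightarrow> ('a \<Rightarrow> 'a \<Rightarrow> complex) \<Rightarrow> ('a \<Rightarrow> real) \<Rightarrow>
   ('a \<Rightarrow> 'a \<Rightarrow> complex) set" where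
  "solving_forms D \<Omega> N =
     {\<Upsilon>. bounded_form \<Upsilon> \<and>
         (\<forall>\<xi>\<in>D. (\<forall>\<eta>\<in>D. \<Omega> \<xi> \<eta> + \<Upsilon> \<xi> \<eta> = 0) \<longrightarrow> \<xi> = 0) \<and>
         (\<forall>\<Lambda>\<in>conj_dual D N. \<exists>\<xi>\<in>D. \<forall>\<eta>\<in>D. \<Lambda> \<eta> = \<Omega> \<xi> \<eta> + \<Upsilon> \<xi> \<eta>)}"

definition solvable ::
  "'a::complex_hilbert set \<Rightarrow> ('a \<Rightarrow> 'a \<Rightarrow> complex) \<Rightarrow> ('a \<Rightarrow> real) \<Rightarrow> bool" where
  "solvable D \<Omega> N \<longleftrightarrow> q_closed D \<Omega> N \<and> solving_forms D \<Omega> N \<noteq> {}"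

section \<open>Operators with a domain\<close>

text \<open>An operator in \<open>H\<close> is a partial map with domain \<^const>\<open>dom\<close>; equality of partial maps is
  equality of operators, \<open>T' \<subseteq>\<^sub>m T\<close> says that \<open>T\<close> extends \<open>T'\<close>, and \<^const>\<open>ran\<close> is the range.\<close>

definition operator :: "('a::complex_vector \<rightharpoonup> 'a) \<Rightarrow> bool" where
  "operator T \<longleftrightarrow>
     csubspace (dom T) \<and>
     (\<forall>x\<in>dom T. \<forall>y\<in>dom T. the (T (x + y)) = the (T x) + the (T y)) \<and>
     (\<forall>c. \<forall>x\<in>dom T. the (T (c *\<^sub>C x)) = c *\<^sub>C the (T x))"

definition closed_operator :: "('a::complex_hilbert \<rightharpoonup> 'a) \<Rightarrow> bool" where
  "closed_operator T \<longleftrightarrow> operator T \<and> closed (Map.graph T)"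

definition bounded_ops :: "('a::complex_hilbert \<rightharpoonup> 'a) set" where
  "bounded_ops = {B. operator B \<and> dom B = UNIV \<and> (\<exists>K. \<forall>x. norm (the (B x)) \<le> K * norm x)}"

definition op_add :: "('a::complex_vector \<rightharpoonup> 'a) \<Rightarrow> ('a \<rightharpoonup> 'a) \<Rightarrow> ('a \<rightharpoonup> 'a)" where
  "op_add S T = (\<lambda>x. if x \<in> dom S \<inter> dom T then Some (the (S x) + the (T x)) else None)"

definition op_scalar :: "complex \<Rightarrow> ('a::complex_vector \<rightharpoonup> 'a)" where
  "op_scalar c = (\<lambda>x. Some (c *\<^sub>C x))"

definition op_invertible :: "('a \<rightharpoonup> 'a) \<Rightarrow> bool" where
  "op_invertible T \<longleftrightarrow> inj_on T (dom T)"

definition op_inverse :: "('a \<rightharpoonup> 'a) \<Rightarrow> ('a \<rightharpoonup> 'a)" where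
  "op_inverse T = (\<lambda>y. if y \<in> ran T then Some (THE x. T x = Some y) else None)"

definition resolvent_set :: "('a::complex_hilbert \<rightharpoonup> 'a) \<Rightarrow> complex set" where
  "resolvent_set T = {l. op_invertible (op_add T (op_scalar (- l))) \<and>
                         op_inverse (op_add T (op_scalar (- l))) \<in> bounded_ops}"

definition represents_on ::
  "('a::complex_hilbert \<rightharpoonup> 'a) \<Rightarrow> ('a \<Rightarrow> 'a \<Rightarrow> complex) \<Rightarrow> 'a set \<Rightarrow> bool" where
  "represents_on T \<Omega> S \<longleftrightarrow> (\<forall>\<xi>\<in>dom T. \<forall>\<eta>\<in>S. \<Omega> \<xi> \<eta> = cinner (the (T \<xi>)) \<eta>)"

end

theory Submission
  imports Defs
begin

text \<open>\<open>T\<close> is the maximal operator with \<open>\<Omega>(\<xi>, \<eta>) = \<langle>T \<xi> | \<eta>\<rangle>\<close>. For a solving form \<open>\<Upsilon>\<close>, represented by \<open>B\<close>,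
  the form \<open>a = \<Omega> + \<Upsilon>\<close> is a bounded bijection of \<open>E = D[N]\<close> onto its conjugate dual, and \<open>T + B\<close> is the part
  of this bijection with values in \<open>H\<close>; hence \<open>T + B\<close> is onto \<open>H\<close>. Pulling the dual norm back along
  \<open>a\<close> gives a second complete norm on \<open>D\<close>, weaker than \<open>N\<close>, so the two are equivalent, and
  \<open>(T + B)\<^sup>-\<^sup>1\<close> is bounded. Reflexivity then shows that every bounded functional on \<open>E\<close> is
  \<open>a(\<cdot>, y)\<close> for some \<open>y\<close>. If it vanishes on \<open>D(T) = (T + B)\<^sup>-\<^sup>1 H\<close>, then \<open>y \<bottom> H\<close>, so
  \<open>y = 0\<close>, and \<open>D(T)\<close> is dense in \<open>E\<close> by Hahn--Banach.\<close>

section \<open>The Hahn--Banach theorem\<close>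

text \<open>No coercivity of a = \<Omega> + \<Upsilon> is assumed, so an estimate of
  \<open>N\<close> by the values of a cannot be read off the form. It has to come from bijectivity,
  through Baire's theorem, and for this both norms on \<open>D\<close> must be complete. For the
  pulled-back norm, completeness is that of the conjugate dual: a limit functional is again bounded,
  and surjectivity turns it into a vector of \<open>D\<close>. Nor is the form assumed symmetric, so
  solvability says nothing directly about functionals of the first variable; this is the gap that
  reflexivity closes. Maximality makes \<open>T\<close> independent of \<Upsilon>: one operator
  serves all solving forms, while closedness and density of the domain are obtained from any one of
  them.\<close>

definition sublinear_on :: "'a::real_vector set \<Rightarrow> ('a \<Rightarrow> real) \<Rightarrow> bool" where
  "sublinear_on V p \<longleftrightarrow>
     (\<forall>x\<in>V. \<forall>y\<in>V. p (x + y) \<le> p x + p y) \<and> (\<forall>x\<in>V. \<forall>c>0. p (c *\<^sub>R x) = c * p x)"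

lemma sublinear_on_add: "sublinear_on V p \<Longrightarrow> x \<in> V \<Longrightarrow> y \<in> V \<Longrightarrow> p (x + y) \<le> p x + p y"
  by (simp add: sublinear_on_def)

lemma sublinear_on_scale: "sublinear_on V p \<Longrightarrow> x \<in> V \<Longrightarrow> c > 0 \<Longrightarrow> p (c *\<^sub>R x) = c * p x"
  by (simp add: sublinear_on_def)

lemma sublinear_on_zero:
  assumes "subspace V" "sublinear_on V p"
  shows "p 0 = 0"
  using sublinear_on_scale[OF assms(2) subspace_0[OF assms(1)], of 2] by simp

lemma sublinear_on_ge_minus:
  assumes "subspace V" "sublinear_on V p" "x \<in> V"
  shows "- p (- x) \<le> p x"
  using sublinear_on_add[OF assms(2,3) subspace_neg[OF assms(1,3)]] sublinear_on_zero[OF assms(1,2)]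
  by simp

text \<open>Sublinear functionals below \<open>p\<close>; the value 0 outside \<open>V\<close> makes the pointwise order
  antisymmetric on them.\<close>

definition sublinear_below :: "'a::real_vector set \<Rightarrow> ('a \<Rightarrow> real) \<Rightarrow> ('a \<Rightarrow> real) set" where
  "sublinear_below V p = {q. sublinear_on V q \<and> (\<forall>x\<in>V. q x \<le> p x) \<and> (\<forall>x. x \<notin> V \<longrightarrow> q x = 0)}"

text \<open>Lowers \<open>p\<close> along a ray: the infimum of
  \<open>p (x + t *\<^sub>R x0) - t * p x0\<close> over t \<ge> 0 is still sublinear, and t = 1
  gives the bound at \<open>- x0\<close>.\<close>

lemma sublinear_below_directional:
  assumes V: "subspace V" and p: "sublinear_on V p" and x0: "x0 \<in> V"
  obtains q where "q \<in> sublinear_below V p" "q (- x0) \<le> - p x0"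
proof
  define h where "h x t = p (x + t *\<^sub>R x0) - t * p x0" for x t
  define q where "q x = (if x \<in> V then INF t\<in>{0..}. h x t else 0)" for x
  have mem: "x + t *\<^sub>R x0 \<in> V" if "x \<in> V" for x t
    using V that x0 by (simp add: subspace_add subspace_scale)
  have bdd: "bdd_below (h x ` {0..})" if "x \<in> V" for x
  proof (rule bdd_belowI2)
    fix t :: real assume t: "t \<in> {0..}"
    have "p (t *\<^sub>R x0) \<le> p (x + t *\<^sub>R x0) + p (- x)"
      using sublinear_on_add[OF p mem[OF that] subspace_neg[OF V that], of t] by simp
    moreover have "p (t *\<^sub>R x0) = t * p x0"
      using t sublinear_on_scale[OF p x0, of t] sublinear_on_zero[OF V p] by (cases "t = 0") auto
    ultimately show "- p (- x) \<le> h x t" by (simp add: h_def)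
  qed
  have le: "q x \<le> h x t" if "x \<in> V" "t \<ge> 0" for x t
    using that bdd by (auto simp: q_def intro!: cINF_lower)
  have ge: "m \<le> q x" if "x \<in> V" "\<And>t. t \<ge> 0 \<Longrightarrow> m \<le> h x t" for x m
    using that by (auto simp: q_def intro!: cINF_greatest)
  have add: "q (x + y) \<le> q x + q y" if x: "x \<in> V" and y: "y \<in> V" for x y
  proof -
    \<comment> \<open>The parameters add: s at \<open>x\<close> and t at \<open>y\<close> give s + t
      at \<open>x + y\<close>. The two infima are then taken one after the other.\<close>
    have 1: "q (x + y) \<le> h x s + h y t" if "s \<ge> 0" "t \<ge> 0" for s t
    proof -
      have "q (x + y) \<le> h (x + y) (s + t)"
        using that V x y by (intro le) (auto simp: subspace_add)
      also have "\<dots> \<le> h x s + h y t"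
        using sublinear_on_add[OF p mem[OF x, of s] mem[OF y, of t]]
        by (simp add: h_def algebra_simps)
      finally show ?thesis .
    qed
    have "q (x + y) - h x s \<le> q y" if "s \<ge> 0" for s
      using 1[OF that] by (intro ge y) (simp add: algebra_simps)
    then have "q (x + y) - q y \<le> q x"
      by (intro ge x) (simp add: algebra_simps)
    then show ?thesis by simp
  qed
  have scale_le: "q (c *\<^sub>R x) \<le> c * q x" if x: "x \<in> V" and c: "c > 0" for x c
  proof -
    have "q (c *\<^sub>R x) / c \<le> h x t" if "t \<ge> 0" for t
    proof -
      have "q (c *\<^sub>R x) \<le> h (c *\<^sub>R x) (c * t)"
        using that c x V by (intro le) (auto simp: subspace_scale)
      also have "\<dots> = c * h x t"
        using sublinear_on_scale[OF p mem[OF x, of t] c] by (simp add: h_def algebra_simps)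
      finally show ?thesis using c by (simp add: field_simps)
    qed
    from ge[OF x this] show ?thesis using c by (simp add: field_simps)
  qed
  have scale: "q (c *\<^sub>R x) = c * q x" if x: "x \<in> V" and c: "c > 0" for x c
  proof (rule antisym[OF scale_le[OF x c]])
    have "q x \<le> inverse c * q (c *\<^sub>R x)"
      using scale_le[of "c *\<^sub>R x" "inverse c"] x c V by (simp add: subspace_scale)
    then show "c * q x \<le> q (c *\<^sub>R x)" using c by (simp add: field_simps)
  qed
  have "q x \<le> p x" if "x \<in> V" for x
    using le[OF that, of 0] by (simp add: h_def)
  then show "q \<in> sublinear_below V p"
    using add scale by (auto simp: sublinear_below_def sublinear_on_def q_def)
  show "q (- x0) \<le> - p x0"
    using le[of "- x0" 1] x0 V sublinear_on_zero[OF V p] by (simp add: h_def subspace_neg)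
qed

text \<open>Zorn's lemma for the reversed pointwise order. A nonempty chain is bounded by its
  pointwise infimum, which is finite because -p(-x) \<le> -q(-x) \<le> q(x) on \<open>V\<close> for
  every member q.\<close>

lemma minimal_sublinear_exists:
  assumes V: "subspace V" and p: "sublinear_on V p"
  obtains g where "g \<in> sublinear_below V p"
    "\<And>q. q \<in> sublinear_below V p \<Longrightarrow> \<forall>x. q x \<le> g x \<Longrightarrow> q = g"
proof -
  let ?A = "sublinear_below V p" and ?P = "\<lambda>q q'::'a \<Rightarrow> real. \<forall>x. q' x \<le> q x"
  have "partial_order_on ?A (relation_of ?P ?A)"
    by (rule partial_order_on_relation_ofI) (auto intro: order_trans intro!: ext order.antisym)
  moreover have "\<exists>u\<in>?A. \<forall>q\<in>C. ?P q u" if C: "C \<in> Chains (relation_of ?P ?A)" for C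
  proof (cases "C = {}")
    case True
    \<comment> \<open>The empty chain needs a bound too: \<open>p\<close> itself, cut off outside
      \<open>V\<close>.\<close>
    have "(\<lambda>x. if x \<in> V then p x else 0) \<in> ?A"
      using p V by (auto simp: sublinear_below_def sublinear_on_def subspace_add subspace_scale)
    with True show ?thesis by auto
  next
    case False
    have CA: "q \<in> ?A" if "q \<in> C" for q
      using C that by (auto simp: Chains_def relation_of_def)
    then have sub: "sublinear_on V q" and qp: "\<And>x. x \<in> V \<Longrightarrow> q x \<le> p x"
        and off: "\<And>x. x \<notin> V \<Longrightarrow> q x = 0" if "q \<in> C" for q
      using that by (auto simp: sublinear_below_def)
    define u where "u x = (INF q\<in>C. q x)" for x
    have bdd: "bdd_below ((\<lambda>q. q x) ` C)" for x
    proof (cases "x \<in> V")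
      case True
      show ?thesis
      proof (rule bdd_belowI2)
        fix q assume q: "q \<in> C"
        show "- p (- x) \<le> q x"
          using sublinear_on_ge_minus[OF V sub[OF q] True] qp[OF q subspace_neg[OF V True]] by linarith
      qed
    next
      case False
      then show ?thesis by (intro bdd_belowI2[of _ 0]) (simp add: off)
    qed
    have le: "u x \<le> q x" if "q \<in> C" for q x
      unfolding u_def by (rule cINF_lower[OF bdd that])
    have ge: "m \<le> u x" if "\<And>q. q \<in> C \<Longrightarrow> m \<le> q x" for m x
      unfolding u_def by (rule cINF_greatest[OF False that])
    have "u (x + y) \<le> u x + u y" if x: "x \<in> V" and y: "y \<in> V" for x y
    proof -
      \<comment> \<open>An infimum of sublinear functionals need not be subadditive; in a chain the
        smaller of \<open>q\<close> and \<open>q'\<close> can be used at both points.\<close>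
      have 1: "u (x + y) \<le> q x + q' y" if q: "q \<in> C" "q' \<in> C" for q q'
      proof -
        have "?P q q' \<or> ?P q' q"
          using C q by (auto simp: Chains_def relation_of_def)
        then show ?thesis
        proof
          assume h: "?P q q'"
          show ?thesis
            using le[OF q(2), of "x + y"] sublinear_on_add[OF sub[OF q(2)] x y] h[rule_format, of x]
            by linarith
        next
          assume h: "?P q' q"
          show ?thesis
            using le[OF q(1), of "x + y"] sublinear_on_add[OF sub[OF q(1)] x y] h[rule_format, of y]
            by linarith
        qed
      qed
      have "u (x + y) - q x \<le> u y" if "q \<in> C" for q
        using 1[OF that] by (intro ge) (simp add: algebra_simps)
      then have "u (x + y) - u y \<le> u x"
        by (intro ge) (simp add: algebra_simps)
      then show ?thesis by simp
    qed
    moreover have "u (c *\<^sub>R x) = c * u x" if x: "x \<in> V" and c: "c > 0" for x c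
    proof (rule antisym)
      have "u (c *\<^sub>R x) / c \<le> u x"
        using le[of _ "c *\<^sub>R x"] sublinear_on_scale[OF sub x c] c
        by (intro ge) (simp add: field_simps)
      then show "u (c *\<^sub>R x) \<le> c * u x" using c by (simp add: field_simps)
      show "c * u x \<le> u (c *\<^sub>R x)"
        using mult_left_mono[OF le[of _ x], of _ c] sublinear_on_scale[OF sub x c] c
        by (intro ge) force
    qed
    moreover have "u x \<le> p x" if "x \<in> V" for x
      using False le qp[OF _ that] by (meson all_not_in_conv order_trans)
    moreover have "u x = 0" if "x \<notin> V" for x
      using False le[of _ x] ge[of 0 x] off[OF _ that] by fastforce
    ultimately have "u \<in> ?A" by (auto simp: sublinear_below_def sublinear_on_def)
    with le show ?thesis by auto
  qed
  ultimately have "\<exists>m\<in>?A. \<forall>q\<in>?A. ?P m q \<longrightarrow> q = m" by (rule predicate_Zorn)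
  then show ?thesis using that by blast
qed

text \<open>A minimal sublinear functional \<open>g\<close> is linear: the functional that
  \<open>sublinear_below_directional\<close> puts below it in direction \<open>x\<close> is \<open>g\<close> itself, so \<open>g\<close> is odd.\<close>

theorem hahn_banach_sublinear:
  assumes V: "subspace V" and p: "sublinear_on V p" and x0: "x0 \<in> V"
  obtains g where "\<And>x y. x \<in> V \<Longrightarrow> y \<in> V \<Longrightarrow> g (x + y) = g x + g y"
    and "\<And>c x. x \<in> V \<Longrightarrow> g (c *\<^sub>R x) = c * g x"
    and "\<And>x. x \<in> V \<Longrightarrow> g x \<le> p x"
    and "g x0 = p x0"
proof -
  \<comment> \<open>Minimality is taken below \<open>q\<close> rather than \<open>p\<close>: this
    keeps \<open>g (- x0) \<le> - p x0\<close>, which becomes \<open>p x0 \<le> g x0\<close> once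
    \<open>g\<close> is odd.\<close>
  obtain q where q: "q \<in> sublinear_below V p" and qx0: "q (- x0) \<le> - p x0"
    by (rule sublinear_below_directional[OF V p x0])
  have q_sub: "sublinear_on V q" using q by (simp add: sublinear_below_def)
  obtain g where g: "g \<in> sublinear_below V q"
    and min: "\<And>r. r \<in> sublinear_below V q \<Longrightarrow> \<forall>x. r x \<le> g x \<Longrightarrow> r = g"
    using minimal_sublinear_exists[OF V q_sub] by blast
  have g_sub: "sublinear_on V g" using g by (simp add: sublinear_below_def)
  have minus: "g (- x) = - g x" if x: "x \<in> V" for x
  proof -
    obtain r where r: "r \<in> sublinear_below V g" and rx: "r (- x) \<le> - g x"
      by (rule sublinear_below_directional[OF V g_sub x])
    have "r y \<le> g y" for y
      using r g by (cases "y \<in> V") (auto simp: sublinear_below_def)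
    moreover have "r \<in> sublinear_below V q"
      using r g by (fastforce simp: sublinear_below_def intro: order_trans)
    ultimately have "r = g" using min by blast
    with rx sublinear_on_ge_minus[OF V g_sub x] show ?thesis by auto
  qed
  have add: "g (x + y) = g x + g y" if x: "x \<in> V" and y: "y \<in> V" for x y
  proof (rule antisym[OF sublinear_on_add[OF g_sub x y]])
    show "g x + g y \<le> g (x + y)"
      using sublinear_on_add[OF g_sub subspace_add[OF V x y] subspace_neg[OF V y]] minus[OF y] by simp
  qed
  have scale: "g (c *\<^sub>R x) = c * g x" if x: "x \<in> V" for c x
  proof (cases c "0::real" rule: linorder_cases)
    case less
    then have "g ((- c) *\<^sub>R x) = (- c) * g x" by (intro sublinear_on_scale[OF g_sub x]) simp
    moreover have "g (- (c *\<^sub>R x)) = - g (c *\<^sub>R x)" by (rule minus[OF subspace_scale[OF V x]])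
    ultimately show ?thesis by simp
  next
    case equal then show ?thesis using sublinear_on_zero[OF V g_sub] by simp
  next
    case greater then show ?thesis by (rule sublinear_on_scale[OF g_sub x])
  qed
  have le: "g x \<le> p x" if "x \<in> V" for x
    using g q that by (fastforce simp: sublinear_below_def intro: order_trans)
  have "g (- x0) \<le> - p x0"
    using g qx0 subspace_neg[OF V x0] by (fastforce simp: sublinear_below_def intro: order_trans)
  then have "g x0 = p x0" using le[OF x0] minus[OF x0] by simp
  with add scale le show ?thesis using that by blast
qed

section \<open>The Riesz representation theorem\<close>

lemma subspace_of_csubspace: "csubspace V \<Longrightarrow> subspace V"
  unfolding subspace_def
  by (simp add: complex_vector.subspace_0 complex_vector.subspace_add scaleR_scaleC
      complex_vector.subspace_scale)

section \<open>Elementary geometry of the inner product\<close>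

lemma cinner_zero_left [simp]: "cinner 0 (y::'a::complex_inner) = 0"
  using cinner_add_left[of 0 0 y] by simp

lemma cinner_zero_right [simp]: "cinner (x::'a::complex_inner) 0 = 0"
  using cinner_commute[of x 0] by simp

lemma cinner_add_right: "cinner (x::'a::complex_inner) (y + z) = cinner x y + cinner x z"
  by (metis cinner_add_left cinner_commute complex_cnj_add)

lemma cinner_scaleC_right: "cinner (x::'a::complex_inner) (c *\<^sub>C y) = cnj c * cinner x y"
  by (metis cinner_scaleC_left cinner_commute complex_cnj_mult)

lemma cinner_scaleR_left: "cinner (r *\<^sub>R (x::'a::complex_inner)) y = of_real r * cinner x y"
  by (simp add: scaleR_scaleC cinner_scaleC_left)

lemma cinner_scaleR_right: "cinner (x::'a::complex_inner) (r *\<^sub>R y) = of_real r * cinner x y"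
  by (simp add: scaleR_scaleC cinner_scaleC_right)

lemma cinner_minus_left: "cinner (- (x::'a::complex_inner)) y = - cinner x y"
  using cinner_scaleR_left[of "-1" x y] by simp

lemma cinner_diff_left: "cinner ((x::'a::complex_inner) - y) z = cinner x z - cinner y z"
  using cinner_add_left[of x "- y" z] by (simp add: cinner_minus_left)

lemma cinner_diff_right: "cinner (x::'a::complex_inner) (y - z) = cinner x y - cinner x z"
  by (metis cinner_diff_left cinner_commute complex_cnj_diff)

lemma cinner_self: "cinner (x::'a::complex_inner) x = of_real ((norm x)\<^sup>2)"
proof (rule complex_eqI)
  show "Re (cinner x x) = Re (of_real ((norm x)\<^sup>2))"
    using cinner_ge_zero[of x] by (simp add: norm_eq_sqrt_cinner)
  show "Im (cinner x x) = Im (of_real ((norm x)\<^sup>2))"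
    using arg_cong[OF cinner_commute[of x x], of Im] by simp
qed

lemma norm_scaleC: "norm (c *\<^sub>C (x::'a::complex_inner)) = cmod c * norm x"
proof -
  have "cinner (c *\<^sub>C x) (c *\<^sub>C x) = (c * cnj c) * cinner x x"
    by (simp add: cinner_scaleC_left cinner_scaleC_right)
  then have "(of_real ((norm (c *\<^sub>C x))\<^sup>2) :: complex) = of_real ((cmod c * norm x)\<^sup>2)"
    by (simp only: cinner_self complex_norm_square[symmetric] power_mult_distrib of_real_mult)
  then have "(norm (c *\<^sub>C x))\<^sup>2 = (cmod c * norm x)\<^sup>2" by (simp only: of_real_eq_iff)
  then show ?thesis by (simp add: power2_eq_iff_nonneg)
qed

lemma norm_add_square: "(norm (x + (y::'a::complex_inner)))\<^sup>2 = (norm x)\<^sup>2 + (norm y)\<^sup>2 + 2 * Re (cinner x y)"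
proof -
  have "cinner (x + y) (x + y) = cinner x x + cinner y y + (cinner x y + cnj (cinner x y))"
    using cinner_commute[of y x] by (simp add: cinner_add_left cinner_add_right)
  then show ?thesis by (simp add: cinner_self complex_eq_iff)
qed

lemma parallelogram_law:
  "(norm ((x::'a::complex_inner) + y))\<^sup>2 + (norm (x - y))\<^sup>2 = 2 * (norm x)\<^sup>2 + 2 * (norm y)\<^sup>2"
  using norm_add_square[of x y] norm_add_square[of x "- y"] cinner_scaleR_right[of x "-1" y] by simp

lemma cinner_Cauchy_Schwarz: "cmod (cinner x (y::'a::complex_inner)) \<le> norm x * norm y"
proof (cases "y = 0")
  case False
  then have ny: "norm y > 0" by simp
  \<comment> \<open>\<open>c *\<^sub>C y\<close> is the orthogonal projection of \<open>x\<close> on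
    \<open>y\<close>; Pythagoras bounds its length by that of \<open>x\<close>.\<close>
  define c where "c = cinner x y / of_real ((norm y)\<^sup>2)"
  have "cinner (x - c *\<^sub>C y) y = 0"
    using ny by (simp add: c_def cinner_diff_left cinner_scaleC_left cinner_self)
  then have "cinner (x - c *\<^sub>C y) (c *\<^sub>C y) = 0" by (simp add: cinner_scaleC_right)
  then have "(norm x)\<^sup>2 = (norm (x - c *\<^sub>C y))\<^sup>2 + (norm (c *\<^sub>C y))\<^sup>2"
    using norm_add_square[of "x - c *\<^sub>C y" "c *\<^sub>C y"] by simp
  then have "(norm (c *\<^sub>C y))\<^sup>2 \<le> (norm x)\<^sup>2" by simp
  then have "norm (c *\<^sub>C y) \<le> norm x" by (rule power2_le_imp_le) simp
  moreover have "cmod c = cmod (cinner x y) / (norm y)\<^sup>2"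
    by (simp add: c_def norm_divide norm_power)
  ultimately show ?thesis using ny
    by (simp add: norm_scaleC power2_eq_square field_simps)
qed simp

lemma tendsto_cinner_left:
  assumes "f \<longlonglongrightarrow> (l::'a::complex_inner)"
  shows "(\<lambda>n. cinner (f n) y) \<longlonglongrightarrow> cinner l y"
proof (rule Lim_transform_bound[THEN LIM_zero_cancel])
  show "\<forall>\<^sub>F n in sequentially. norm (cinner (f n) y - cinner l y) \<le> norm (norm (f n - l) * norm y)"
    using cinner_Cauchy_Schwarz[of "f _ - l" y] by (intro always_eventually) (simp add: cinner_diff_left)
  show "(\<lambda>n. norm (f n - l) * norm y) \<longlonglongrightarrow> 0"
    using assms by (intro tendsto_mult_left_zero tendsto_norm_zero LIM_zero)
qed

text \<open>Test against a sequence in \<open>D\<close> converging to \<open>x - y\<close> itself.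
  This makes the vector representing a functional on a dense subspace unique.\<close>

lemma cinner_eq_on_dense:
  fixes x y :: "'a::complex_inner"
  assumes "closure D = UNIV" "\<And>\<eta>. \<eta> \<in> D \<Longrightarrow> cinner x \<eta> = cinner y \<eta>"
  shows "x = y"
proof -
  obtain f where f: "\<And>n. f n \<in> D" "f \<longlonglongrightarrow> x - y"
    using assms(1) closure_sequential[of "x - y" D] by auto
  have "cinner (f n) (x - y) = 0" for n
    using assms(2)[OF f(1), of n] cinner_commute[of "f n" "x - y"] by (simp add: cinner_diff_left)
  then have "cinner (x - y) (x - y) = 0"
    using tendsto_cinner_left[OF f(2), of "x - y"] LIMSEQ_unique[of "\<lambda>_. 0::complex"] by fastforce
  then show ?thesis by (simp add: cinner_eq_zero_iff)
qed

text \<open>The representing vector minimises \<open>\<parallel>x\<parallel>\<^sup>2 - 2 Re f(x)\<close>; minimising sequences are Cauchy by the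
  parallelogram law.\<close>

theorem Riesz_representation:
  fixes f :: "'a::complex_hilbert \<Rightarrow> complex"
  assumes add: "\<And>x y. f (x + y) = f x + f y"
    and scale: "\<And>c x. f (c *\<^sub>C x) = cnj c * f x"
    and bound: "\<And>x. cmod (f x) \<le> K * norm x"
  obtains z where "\<And>x. f x = cinner z x"
proof -
  define J where "J x = (norm x)\<^sup>2 - 2 * Re (f x)" for x
  have scaleR: "f (r *\<^sub>R x) = of_real r * f x" for r x
    using scale[of "of_real r" x] by (simp add: scaleR_scaleC)
  have diff: "f (x - y) = f x - f y" for x y
    using add[of x "- y"] scaleR[of "-1" y] by simp
  \<comment> \<open>Completing the square: the minimum of s^2 - 2 K s is - K^2.\<close>
  have J_ge: "- K\<^sup>2 \<le> J x" for x
  proof -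
    have "Re (f x) \<le> K * norm x" using complex_Re_le_cmod[of "f x"] bound[of x] by linarith
    moreover have "0 \<le> (norm x - K)\<^sup>2" by simp
    ultimately show ?thesis by (simp add: J_def power2_eq_square algebra_simps)
  qed
  then have bdd: "bdd_below (range J)" by (rule bdd_belowI2)
  define m where "m = Inf (range J)"
  have m_le: "m \<le> J x" for x unfolding m_def using bdd by (auto intro: cInf_lower)
  have "\<exists>x. J x < m + 1 / real (Suc n)" for n
    using cInf_less_iff[OF _ bdd, of "m + 1 / real (Suc n)"] by (auto simp: m_def)
  then obtain X where X: "\<And>n. J (X n) < m + 1 / real (Suc n)" by metis
  \<comment> \<open>The midpoint of \<open>x\<close> and \<open>y\<close> has \<open>J\<close> at
    least \<open>m\<close>; inserted into the parallelogram law, this shows that near-minimisers are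
    close together.\<close>
  have dist_le: "(norm (x - y))\<^sup>2 \<le> 2 * (J x - m) + 2 * (J y - m)" for x y
  proof -
    have "4 * J ((1/2) *\<^sub>R (x + y)) = (norm (x + y))\<^sup>2 - 4 * Re (f x + f y)"
    proof -
      have "(norm ((1/2) *\<^sub>R (x + y)))\<^sup>2 = (norm (x + y))\<^sup>2 / 4"
        unfolding norm_scaleR by (simp add: power_divide)
      moreover have "Re (f ((1/2) *\<^sub>R (x + y))) = Re (f x + f y) / 2"
        unfolding scaleR add by simp
      ultimately show ?thesis unfolding J_def by simp
    qed
    then show ?thesis
      using parallelogram_law[of x y] m_le[of "(1/2) *\<^sub>R (x + y)"] by (simp add: J_def)
  qed
  have "Cauchy X"
  proof (rule metric_CauchyI)
    fix e :: real assume "0 < e"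
    \<comment> \<open>Each of the two excesses enters \<open>dist_le\<close> with factor 2, so e^2 /
      4 for each adds up to e^2.\<close>
    then obtain n0 where n0: "1 / real (Suc n0) < e\<^sup>2 / 4"
      using reals_Archimedean[of "e\<^sup>2 / 4"] by (auto simp: inverse_eq_divide)
    have small: "J (X n) - m < e\<^sup>2 / 4" if "n \<ge> n0" for n
      using X[of n] n0 that frac_le[of 1 1 "real (Suc n0)" "real (Suc n)"] by simp
    have "dist (X i) (X j) < e" if "i \<ge> n0" "j \<ge> n0" for i j
    proof -
      have "(norm (X i - X j))\<^sup>2 < e\<^sup>2"
        using dist_le[of "X i" "X j"] small[OF that(1)] small[OF that(2)] by argo
      then show ?thesis using \<open>0 < e\<close> by (simp add: dist_norm power_less_imp_less_base)
    qed
    then show "\<exists>M. \<forall>i\<ge>M. \<forall>j\<ge>M. dist (X i) (X j) < e" by blast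
  qed
  then obtain z where z: "X \<longlonglongrightarrow> z" using Cauchy_convergent convergent_def by blast
  have "(\<lambda>n. f (X n) - f z) \<longlonglongrightarrow> 0"
  proof (rule Lim_transform_bound)
    show "\<forall>\<^sub>F n in sequentially. norm (f (X n) - f z) \<le> norm (K * norm (X n - z))"
      using order_trans[OF bound[of "X _ - z"] abs_ge_self]
      by (intro always_eventually) (simp only: diff real_norm_def simp_thms)
    show "(\<lambda>n. K * norm (X n - z)) \<longlonglongrightarrow> 0"
      using z by (intro tendsto_mult_right_zero tendsto_norm_zero LIM_zero)
  qed
  then have "(\<lambda>n. f (X n)) \<longlonglongrightarrow> f z" by (rule LIM_zero_cancel)
  then have "(\<lambda>n. J (X n)) \<longlonglongrightarrow> J z" unfolding J_def using z by (intro tendsto_intros)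
  moreover have "(\<lambda>n. m + 1 / real (Suc n)) \<longlonglongrightarrow> m"
    using tendsto_add[OF tendsto_const[of m] LIMSEQ_inverse_real_of_nat]
    by (simp add: inverse_eq_divide)
  ultimately have "J z \<le> m"
    by (rule LIMSEQ_le) (use X less_imp_le in blast)
  then have min: "J z \<le> J x" for x using m_le[of x] by linarith
  have Re_eq: "Re (cinner z v) = Re (f v)" for v
  proof (rule ccontr)
    define d where "d = Re (f v) - Re (cinner z v)"
    assume "Re (cinner z v) \<noteq> Re (f v)"
    then have d: "d \<noteq> 0" by (simp add: d_def)
    have J_line: "J (z + t *\<^sub>R v) = J z + t\<^sup>2 * (norm v)\<^sup>2 - 2 * t * d" for t
      by (simp add: J_def norm_add_square add scaleR cinner_scaleR_right d_def algebra_simps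
          power_mult_distrib)
    \<comment> \<open>Along \<open>v\<close> the linear coefficient of \<open>J\<close> is -2 d, so
      the step t = d / w would lower \<open>J\<close> by at least d^2 / w. The summand 1 makes
      \<open>w\<close> positive whatever \<open>v\<close> is.\<close>
    define w where "w = (norm v)\<^sup>2 + 1"
    have w: "w > 0" by (simp add: w_def add_nonneg_pos)
    have "2 * (d / w) * d \<le> (d / w)\<^sup>2 * (norm v)\<^sup>2"
      using min[of "z + (d / w) *\<^sub>R v"] J_line[of "d / w"] by simp
    also have "\<dots> \<le> (d / w)\<^sup>2 * w" by (intro mult_left_mono) (auto simp: w_def)
    also have "\<dots> = (d / w) * d" using w by (simp add: power2_eq_square)
    finally have "d * d / w \<le> 0" by simp
    with d w show False by (auto simp: divide_le_0_iff mult_le_0_iff)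
  qed
  have "f x = cinner z x" for x
  proof (rule complex_eqI)
    show "Re (f x) = Re (cinner z x)" using Re_eq by simp
    show "Im (f x) = Im (cinner z x)"
      using Re_eq[of "\<i> *\<^sub>C x"] by (simp add: scale cinner_scaleC_right)
  qed
  then show ?thesis using that by blast
qed

section \<open>Norms on subspaces\<close>

text \<open>Carrier and norm are parameters rather than a type class, since \<open>D\<close> already
  carries the norm of H and later two further norms are compared on it.\<close>

locale normed_subspace =
  fixes V :: "'a::complex_vector set" and N :: "'a \<Rightarrow> real"
  assumes csubspace_V: "csubspace V" and norm_on_N: "norm_on V N"
begin

sublocale Metric_space V "norm_dist V N"
  by (rule Metric_space_norm_dist[OF csubspace_V norm_on_N])

lemmas zero_mem = complex_vector.subspace_0[OF csubspace_V]
lemmas add_mem = complex_vector.subspace_add[OF csubspace_V]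
lemmas diff_mem = complex_vector.subspace_diff[OF csubspace_V]
lemmas scaleC_mem = complex_vector.subspace_scale[OF csubspace_V]

lemma scaleR_mem: "x \<in> V \<Longrightarrow> r *\<^sub>R x \<in> V"
  by (simp add: scaleR_scaleC scaleC_mem)

lemma N_nonneg: "x \<in> V \<Longrightarrow> 0 \<le> N x"
  and N_eq_0_iff: "x \<in> V \<Longrightarrow> N x = 0 \<longleftrightarrow> x = 0"
  and N_scaleC: "x \<in> V \<Longrightarrow> N (c *\<^sub>C x) = cmod c * N x"
  and N_triangle: "x \<in> V \<Longrightarrow> y \<in> V \<Longrightarrow> N (x + y) \<le> N x + N y"
  using norm_on_N by (auto simp: norm_on_def)

lemma N_zero: "N 0 = 0"
  using N_eq_0_iff[OF zero_mem] by simp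

lemma N_scaleR: "x \<in> V \<Longrightarrow> N (r *\<^sub>R x) = \<bar>r\<bar> * N x"
  by (simp add: scaleR_scaleC N_scaleC)

lemma N_minus: "x \<in> V \<Longrightarrow> N (- x) = N x"
  using N_scaleR[of x "- 1"] by simp

lemma N_minus_commute: "x \<in> V \<Longrightarrow> y \<in> V \<Longrightarrow> N (x - y) = N (y - x)"
  using N_minus[OF diff_mem, of x y] by simp

lemma N_triangle_diff: "x \<in> V \<Longrightarrow> y \<in> V \<Longrightarrow> N (x - y) \<le> N x + N y"
  using N_triangle[of x "- y"] N_minus[of y] scaleR_mem[of y "- 1"] by simp

lemma MCauchy_iff:
  "MCauchy \<sigma> \<longleftrightarrow> range \<sigma> \<subseteq> V \<and> (\<forall>e>0. \<exists>n0. \<forall>m n. n0 \<le> m \<longrightarrow> n0 \<le> n \<longrightarrow> N (\<sigma> m - \<sigma> n) < e)"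
  unfolding MCauchy_def by (auto simp: norm_dist_def image_subset_iff)

lemma limitin_iff:
  assumes "range \<sigma> \<subseteq> V"
  shows "limitin mtopology \<sigma> x sequentially \<longleftrightarrow> x \<in> V \<and> (\<lambda>n. N (\<sigma> n - x)) \<longlonglongrightarrow> 0"
  using assms
  by (auto simp: limit_metric_sequentially norm_dist_def image_subset_iff LIMSEQ_iff
      N_nonneg diff_mem)

lemma dense_wrt_iff:
  "dense_wrt V N S \<longleftrightarrow> S \<subseteq> V \<and> (\<forall>x\<in>V. \<forall>e>0. \<exists>y\<in>S. N (x - y) < e)"
proof -
  have "mtopology closure_of S = V \<longleftrightarrow> (\<forall>x\<in>V. \<forall>e>0. \<exists>y\<in>S. N (x - y) < e)" if "S \<subseteq> V"
  proof -
    have "mtopology closure_of S = {x \<in> V. \<forall>e>0. \<exists>y\<in>S. N (x - y) < e}"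
      unfolding metric_closure_of using that by (intro Collect_cong) (auto simp: norm_dist_def subset_iff)
    moreover have "{x \<in> V. Q x} = V \<longleftrightarrow> (\<forall>x\<in>V. Q x)" for Q by blast
    ultimately show ?thesis by simp
  qed
  then show ?thesis unfolding dense_wrt_def by blast
qed

lemma convergent_if_MCauchy:
  assumes "mcomplete" "MCauchy \<sigma>"
  obtains x where "x \<in> V" "(\<lambda>n. N (\<sigma> n - x)) \<longlonglongrightarrow> 0"
proof -
  have "range \<sigma> \<subseteq> V" using assms(2) by (simp add: MCauchy_iff)
  moreover obtain x where "limitin mtopology \<sigma> x sequentially"
    using assms unfolding mcomplete_def by blast
  ultimately show ?thesis using that by (auto simp: limitin_iff)
qed

text \<open>Only the modulus of \<open>f\<close> has to be homogeneous, so that conjugate linear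
  functionals are covered as well.\<close>

lemma functional_bounds:
  fixes f :: "'a \<Rightarrow> complex"
  assumes bound: "\<And>x. x \<in> V \<Longrightarrow> cmod (f x) \<le> K * N x"
  shows dual_norm_nonneg: "0 \<le> dual_norm V N f"
    and dual_norm_le: "K \<ge> 0 \<Longrightarrow> dual_norm V N f \<le> K"
    and dual_norm_upper: "(\<And>c x. x \<in> V \<Longrightarrow> cmod (f (c *\<^sub>C x)) = cmod c * cmod (f x)) \<Longrightarrow>
      x \<in> V \<Longrightarrow> cmod (f x) \<le> dual_norm V N f * N x"
proof -
  have le: "cmod (f x) \<le> \<bar>K\<bar>" if "x \<in> V" "N x \<le> 1" for x
  proof -
    have "K * N x \<le> \<bar>K\<bar> * 1"
      using that N_nonneg[of x] by (intro mult_mono) auto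
    then show ?thesis using bound[OF that(1)] by simp
  qed
  have bdd: "bdd_above ((\<lambda>x. cmod (f x)) ` {x \<in> V. N x \<le> 1})"
    using le by (intro bdd_aboveI2[of _ _ "\<bar>K\<bar>"]) simp
  have upper: "cmod (f x) \<le> dual_norm V N f" if "x \<in> V" "N x \<le> 1" for x
    unfolding dual_norm_def using that bdd by (intro cSUP_upper) auto
  show "0 \<le> dual_norm V N f"
    using upper[OF zero_mem] N_zero norm_ge_zero[of "f 0"] by linarith
  show "dual_norm V N f \<le> K" if "K \<ge> 0"
    unfolding dual_norm_def
  proof (rule cSUP_least)
    show "{x \<in> V. N x \<le> 1} \<noteq> {}" using zero_mem N_zero by auto
  qed (use le that in auto)
  show "cmod (f x) \<le> dual_norm V N f * N x"
    if hom: "\<And>c x. x \<in> V \<Longrightarrow> cmod (f (c *\<^sub>C x)) = cmod c * cmod (f x)" and x: "x \<in> V"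
  proof (cases "x = 0")
    case True
    then show ?thesis using bound[OF x] N_zero by simp
  next
    case False
    then have Nx: "N x > 0" using N_nonneg[OF x] N_eq_0_iff[OF x] by linarith
    define c where "c = complex_of_real (inverse (N x))"
    have c: "cmod c = inverse (N x)" using Nx by (simp add: c_def norm_inverse)
    have "cmod (f (c *\<^sub>C x)) \<le> dual_norm V N f"
      using Nx x by (intro upper) (auto simp: scaleC_mem N_scaleC c)
    then show ?thesis using Nx by (simp add: hom[OF x] c field_simps)
  qed
qed

text \<open>Hahn--Banach is applied to the distance from \<open>M\<close>, a seminorm that vanishes on \<open>M\<close>.\<close>

lemma dense_wrt_if_annihilator_trivial:
  assumes M: "csubspace M" "M \<subseteq> V"
    and ann: "\<And>f x. f \<in> dual V N \<Longrightarrow> \<forall>y\<in>M. f y = 0 \<Longrightarrow> x \<in> V \<Longrightarrow> f x = 0"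
  shows "dense_wrt V N M"
proof (rule ccontr)
  assume "\<not> dense_wrt V N M"
  then obtain x0 e where x0: "x0 \<in> V" and e: "e > 0" "\<And>y. y \<in> M \<Longrightarrow> e \<le> N (x0 - y)"
    using M unfolding dense_wrt_iff by (meson not_less)
  have M0: "0 \<in> M" and M_add: "\<And>x y. x \<in> M \<Longrightarrow> y \<in> M \<Longrightarrow> x + y \<in> M"
    and M_scale: "\<And>c x. x \<in> M \<Longrightarrow> c *\<^sub>C x \<in> M"
    using M(1) by (simp_all add: complex_vector.subspace_0 complex_vector.subspace_add
        complex_vector.subspace_scale)
  have M_scaleR: "r *\<^sub>R x \<in> M" if "x \<in> M" for r x
    using that M_scale by (simp add: scaleR_scaleC)
  define p where "p x = (INF y\<in>M. N (x - y))" for x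
  have nonneg: "0 \<le> N (x - y)" if "x \<in> V" "y \<in> M" for x y
    using that M N_nonneg diff_mem by blast
  have le: "p x \<le> N (x - y)" if "x \<in> V" "y \<in> M" for x y
    unfolding p_def using that nonneg by (intro cINF_lower bdd_belowI2[of _ 0]) auto
  have ge: "m \<le> p x" if "\<And>y. y \<in> M \<Longrightarrow> m \<le> N (x - y)" for x m
    unfolding p_def using that M0 by (intro cINF_greatest) auto
  have "p (x + y) \<le> p x + p y" if x: "x \<in> V" and y: "y \<in> V" for x y
  proof -
    have 1: "p (x + y) \<le> N (x - u) + N (y - v)" if "u \<in> M" "v \<in> M" for u v
    proof -
      have uv: "x - u \<in> V" "y - v \<in> V" using that M x y diff_mem by auto
      have "p (x + y) \<le> N ((x + y) - (u + v))"
        using that x y by (intro le add_mem M_add)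
      also have "(x + y) - (u + v) = (x - u) + (y - v)" by simp
      also have "N \<dots> \<le> N (x - u) + N (y - v)" by (rule N_triangle[OF uv])
      finally show ?thesis .
    qed
    have "p (x + y) - N (x - u) \<le> p y" if "u \<in> M" for u
      using 1[OF that] by (intro ge) (simp add: algebra_simps)
    then have "p (x + y) - p y \<le> p x" by (intro ge) (simp add: algebra_simps)
    then show ?thesis by simp
  qed
  moreover have scale_le: "p (c *\<^sub>R x) \<le> c * p x" if x: "x \<in> V" and c: "c > 0" for x c
  proof -
    have "p (c *\<^sub>R x) / c \<le> N (x - y)" if y: "y \<in> M" for y
    proof -
      have "p (c *\<^sub>R x) \<le> N (c *\<^sub>R x - c *\<^sub>R y)"
        by (intro le scaleR_mem x M_scaleR y)
      also have "\<dots> = c * N (x - y)"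
        using N_scaleR[of "x - y" c] x y M c diff_mem by (auto simp: scaleR_diff_right)
      finally show ?thesis using c by (simp add: field_simps)
    qed
    from ge[OF this] show ?thesis using c by (simp add: field_simps)
  qed
  moreover have "c * p x \<le> p (c *\<^sub>R x)" if x: "x \<in> V" and c: "c > 0" for x c
    using scale_le[of "c *\<^sub>R x" "inverse c"] scaleR_mem[OF x] c by (simp add: field_simps)
  ultimately have "sublinear_on V p" by (auto simp: sublinear_on_def intro: order.antisym)
  then obtain g where g_add: "\<And>x y. x \<in> V \<Longrightarrow> y \<in> V \<Longrightarrow> g (x + y) = g x + g y"
    and g_scale: "\<And>c x. x \<in> V \<Longrightarrow> g (c *\<^sub>R x) = c * g x"
    and g_le: "\<And>x. x \<in> V \<Longrightarrow> g x \<le> p x" and g_x0: "g x0 = p x0"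
    using hahn_banach_sublinear[OF subspace_of_csubspace[OF csubspace_V] _ x0] by metis
  have g_minus: "g (- x) = - g x" if "x \<in> V" for x
    using g_scale[OF that, of "- 1"] by simp
  \<comment> \<open>The choice y = 0 will give boundedness, and y = x for x in \<open>M\<close> will
    give vanishing on \<open>M\<close>.\<close>
  have g_abs: "\<bar>g x\<bar> \<le> N (x - y)" if x: "x \<in> V" and y: "y \<in> M" for x y
  proof -
    have yV: "y \<in> V" using y M by blast
    have m: "- x \<in> V" "- y \<in> M" using scaleR_mem[OF x, of "- 1"] M_scaleR[OF y, of "- 1"] by auto
    have "g (- x) \<le> N (- x - - y)" using g_le[OF m(1)] le[OF m] by linarith
    then show ?thesis
      using g_le[OF x] le[OF x y] g_minus[OF x] N_minus_commute[OF x yV] by simp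
  qed
  \<comment> \<open>The usual complexification: the real part is \<open>g\<close>, and complex
    linearity forces the imaginary part.\<close>
  define f where "f x = (if x \<in> V then Complex (g x) (- g (\<i> *\<^sub>C x)) else 0)" for x
  have f_scaleR: "f (r *\<^sub>R x) = of_real r * f x" if x: "x \<in> V" for r x
    using g_scale[OF x, of r] g_scale[OF scaleC_mem[OF x, of \<i>], of r] x
    by (simp add: f_def scaleR_mem complex_eq_iff scaleR_scaleC scaleC_scaleC scaleC_mem mult.commute)
  have f_i: "f (\<i> *\<^sub>C x) = \<i> * f x" if x: "x \<in> V" for x
    using g_minus[OF x] x
    by (simp add: f_def scaleC_mem complex_eq_iff scaleC_scaleC)
  have f_add: "f (x + y) = f x + f y" if "x \<in> V" "y \<in> V" for x y
    using that by (simp add: f_def add_mem g_add scaleC_mem scaleC_add_right complex_eq_iff)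
  have f_scale: "f (c *\<^sub>C x) = c * f x" if x: "x \<in> V" for c x
  proof -
    have "c *\<^sub>C x = Re c *\<^sub>R x + Im c *\<^sub>R (\<i> *\<^sub>C x)"
      by (simp add: scaleR_scaleC scaleC_scaleC scaleC_add_left[symmetric])
        (metis complex_eq mult.commute)
    then have "f (c *\<^sub>C x) = of_real (Re c) * f x + of_real (Im c) * (\<i> * f x)"
      by (simp add: f_add f_scaleR f_i x scaleR_mem scaleC_mem)
    also have "\<dots> = c * f x" by (subst (3) complex_eq) (simp add: algebra_simps)
    finally show ?thesis .
  qed
  \<comment> \<open>The 2 counts real and imaginary part separately; any bound puts \<open>f\<close>
    in the dual.\<close>
  have "cmod (f x) \<le> 2 * N x" if x: "x \<in> V" for x
    using cmod_le[of "f x"] g_abs[OF x M0] g_abs[OF scaleC_mem[OF x, of \<i>] M0] x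
    by (simp add: f_def N_scaleC)
  then have "f \<in> dual V N"
    using f_add f_scale by (auto simp: dual_def f_def)
  moreover have "f y = 0" if y: "y \<in> M" for y
    using g_abs[of y y] g_abs[of "\<i> *\<^sub>C y" "\<i> *\<^sub>C y"] y M M_scale[OF y, of \<i>] N_zero
    by (auto simp: f_def complex_eq_iff subset_iff)
  ultimately have "f x0 = 0" using ann x0 by blast
  then have "p x0 = 0" using x0 g_x0 by (simp add: f_def complex_eq_iff)
  with ge[of e x0] e show False by simp
qed

end

text \<open>The open mapping theorem for the identity map between two norms.\<close>

theorem complete_norms_equivalent:
  assumes "normed_subspace V N" and "normed_subspace V P"
    and complete_N: "Metric_space.mcomplete V (norm_dist V N)"
    and complete_P: "Metric_space.mcomplete V (norm_dist V P)"
    and P_le: "\<And>x. x \<in> V \<Longrightarrow> P x \<le> C * N x"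
  obtains c where "c \<ge> 0" "\<And>x. x \<in> V \<Longrightarrow> N x \<le> c * P x"
proof -
  interpret N: normed_subspace V N by fact
  interpret P: normed_subspace V P by fact
  \<comment> \<open>These P-closures of N-balls cover \<open>V\<close>, so by Baire's theorem for
    the complete norm \<open>P\<close> one of them contains a P-ball.\<close>
  define A where "A n = P.mtopology closure_of {x \<in> V. N x \<le> real n}" for n
  have "\<Union> (range A) = V"
  proof -
    have "x \<in> A (nat \<lceil>N x\<rceil>)" if "x \<in> V" for x
      using that N.N_nonneg[OF that] unfolding A_def
      by (intro closure_of_subset[THEN subsetD]) auto
    moreover have "A n \<subseteq> V" for n
      unfolding A_def using closure_of_subset_topspace[of P.mtopology] by simp
    ultimately show ?thesis by blast
  qed
  moreover have "P.mtopology interior_of V \<noteq> {}"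
    using interior_of_topspace[of P.mtopology] P.zero_mem by auto
  ultimately obtain n where "P.mtopology interior_of (A n) \<noteq> {}"
    using P.metric_Baire_category_alt[OF complete_P, of "range A"] unfolding A_def by fastforce
  then obtain x0 r where x0: "x0 \<in> V" and r: "r > 0" and ball: "P.mball x0 r \<subseteq> A n"
    unfolding P.metric_interior_of by auto
  have approx: "\<exists>u\<in>V. N u \<le> n \<and> P (x - u) < e" if "x \<in> V" "P (x0 - x) < r" "e > 0" for x e
    using ball that x0 unfolding A_def P.metric_closure_of
    by (fastforce simp: norm_dist_def subset_iff)
  define K where "K = 4 * real n / r"
  have K: "K \<ge> 0" using r by (simp add: K_def)
  \<comment> \<open>Both the centre \<open>x0\<close> and a nearby point
    \<open>x0 + t *\<^sub>R x\<close> are P-approximated by vectors of \<open>N\<close> at most n;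
    their rescaled difference approximates \<open>x\<close>.\<close>
  have "\<exists>w\<in>V. N w \<le> K * P x \<and> P (x - w) \<le> P x / 2" if x: "x \<in> V" for x
  proof (cases "x = 0")
    case True
    then show ?thesis using P.zero_mem by (intro bexI[of _ 0]) (auto simp: N.N_zero P.N_zero)
  next
    case False
    then have Px: "P x > 0" using P.N_nonneg[OF x] P.N_eq_0_iff[OF x] by linarith
    \<comment> \<open>With this scaling \<open>t *\<^sub>R x\<close> has P-norm r / 2 and stays in
      the ball. The factor 1 / t = 2 P(x) / r turns the two errors r / 8 into P(x) / 2 and the
      N-bound 2 n into K P(x).\<close>
    define t where "t = r / (2 * P x)"
    have t: "t > 0" using Px r by (simp add: t_def)
    have tx: "t *\<^sub>R x \<in> V" by (rule P.scaleR_mem[OF x])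
    have "P (x0 - (x0 + t *\<^sub>R x)) < r"
      using P.N_minus[OF tx] P.N_scaleR[OF x, of t] Px r t by (simp add: t_def)
    then obtain u where u: "u \<in> V" "N u \<le> n" "P ((x0 + t *\<^sub>R x) - u) < r / 8"
      using approx[OF P.add_mem[OF x0 tx], of "r / 8"] r by auto
    obtain v where v: "v \<in> V" "N v \<le> n" "P (x0 - v) < r / 8"
      using approx[OF x0, of "r / 8"] r P.N_zero by auto
    define w where "w = inverse t *\<^sub>R (u - v)"
    have wV: "w \<in> V" unfolding w_def by (intro P.scaleR_mem P.diff_mem u v)
    have "N w = inverse t * N (u - v)"
      unfolding w_def using t N.N_scaleR[OF P.diff_mem[OF u(1) v(1)]] by simp
    also have "\<dots> \<le> inverse t * (2 * real n)"
      using N.N_triangle_diff[OF u(1) v(1)] u(2) v(2) t by (intro mult_left_mono) auto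
    also have "\<dots> = K * P x" by (simp add: t_def K_def)
    finally have Nw: "N w \<le> K * P x" .
    have xw: "x - w = inverse t *\<^sub>R (((x0 + t *\<^sub>R x) - u) - (x0 - v))"
      using t by (simp add: w_def algebra_simps)
    have "P (x - w) = inverse t * P (((x0 + t *\<^sub>R x) - u) - (x0 - v))"
      unfolding xw using t by (subst P.N_scaleR) (auto intro!: P.diff_mem P.add_mem x0 tx u v)
    also have "\<dots> \<le> inverse t * (r / 4)"
      using P.N_triangle_diff[OF P.diff_mem[OF P.add_mem[OF x0 tx] u(1)] P.diff_mem[OF x0 v(1)]]
        u(3) v(3) t
      by (intro mult_left_mono) auto
    also have "\<dots> = P x / 2" using r by (simp add: t_def)
    finally show ?thesis using Nw wV by blast
  qed
  then obtain W where W: "\<And>x. x \<in> V \<Longrightarrow> W x \<in> V" "\<And>x. x \<in> V \<Longrightarrow> N (W x) \<le> K * P x"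
    "\<And>x. x \<in> V \<Longrightarrow> P (x - W x) \<le> P x / 2"
    by metis
  have "N x \<le> 2 * K * P x" if x: "x \<in> V" for x
  proof -
    \<comment> \<open>The residual after k corrections. Its P-norm is at least halved each time, so
      the N-norms of the corrections are dominated by a geometric series with sum 2 K P(x).\<close>
    define R where "R k = ((\<lambda>y. y - W y) ^^ k) x" for k
    have R0: "R 0 = x" and R_Suc: "R (Suc k) = R k - W (R k)" for k
      by (simp_all add: R_def)
    have RV: "R k \<in> V" for k
      by (induction k) (auto simp: R0 R_Suc x P.diff_mem W)
    have PR: "P (R k) \<le> P x / 2 ^ k" for k
    proof (induction k)
      case (Suc k)
      then show ?case using W(3)[OF RV[of k]] by (simp add: R_Suc)
    qed (simp add: R0)
    have diff: "N (R k - R (k + j)) \<le> 2 * K * P x / 2 ^ k - 2 * K * P x / 2 ^ (k + j)" for k j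
    proof (induction j)
      case (Suc j)
      have "N (R k - R (k + Suc j)) = N ((R k - R (k + j)) + W (R (k + j)))"
        by (simp only: add_Suc_right R_Suc diff_diff_eq2 diff_add_eq)
      also have "\<dots> \<le> N (R k - R (k + j)) + N (W (R (k + j)))"
        by (intro N.N_triangle N.diff_mem RV W)
      also have "N (W (R (k + j))) \<le> K * (P x / 2 ^ (k + j))"
        using W(2)[OF RV[of "k + j"]] mult_left_mono[OF PR[of "k + j"] K] by linarith
      finally show ?case using Suc by simp
    qed (simp add: N.N_zero)
    have KPx: "0 \<le> K * P x" using K P.N_nonneg[OF x] by simp
    have diff': "N (R k - R l) \<le> 2 * K * P x / 2 ^ k" if "k \<le> l" for k l
      using diff[of k "l - k"] that KPx by (simp add: order_trans)
    have lim0: "(\<lambda>k. M / 2 ^ k) \<longlonglongrightarrow> 0" for M :: real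
      using tendsto_mult_right_zero[OF LIMSEQ_power_zero[of "1/2::real"], of M]
      by (simp add: power_divide)
    have "N.MCauchy R"
      unfolding N.MCauchy_iff
    proof (intro conjI allI impI)
      show "range R \<subseteq> V" using RV by blast
      fix e :: real assume "e > 0"
      then obtain n0 where n0: "\<And>k. k \<ge> n0 \<Longrightarrow> 2 * K * P x / 2 ^ k < e"
        using order_tendstoD(2)[OF lim0] unfolding eventually_sequentially by blast
      have "N (R k - R l) < e" if "n0 \<le> k" "n0 \<le> l" for k l
        using diff'[of k l] diff'[of l k] n0[OF that(1)] n0[OF that(2)]
          N.N_minus_commute[OF RV[of k] RV[of l]] by (cases "k \<le> l") auto
      then show "\<exists>n0. \<forall>k l. n0 \<le> k \<longrightarrow> n0 \<le> l \<longrightarrow> N (R k - R l) < e" by blast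
    qed
    then obtain s where s: "s \<in> V" "(\<lambda>k. N (R k - s)) \<longlonglongrightarrow> 0"
      by (rule N.convergent_if_MCauchy[OF complete_N])
    \<comment> \<open>The residuals tend to 0 for \<open>P\<close> and to \<open>s\<close> for
      \<open>N\<close>. As the identity is continuous from \<open>N\<close> to \<open>P\<close>, the
      limits agree.\<close>
    have "P s \<le> C * N (R k - s) + P x / 2 ^ k" for k
    proof -
      have "P s \<le> P (R k - s) + P (R k)"
        using P.N_triangle_diff[OF RV[of k] P.diff_mem[OF RV[of k] s(1)]] by simp
      then show ?thesis using P_le[OF P.diff_mem[OF RV[of k] s(1)]] PR[of k] by linarith
    qed
    moreover have "(\<lambda>k. C * N (R k - s) + P x / 2 ^ k) \<longlonglongrightarrow> 0"
      using tendsto_add[OF tendsto_mult_right_zero[OF s(2), of C] lim0[of "P x"]] by simp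
    ultimately have "P s \<le> 0" by (intro LIMSEQ_le_const) auto
    then have "s = 0" using P.N_nonneg[OF s(1)] P.N_eq_0_iff[OF s(1)] by simp
    have "N x \<le> 2 * K * P x + N (R k - s)" for k
      using N.N_triangle[OF P.diff_mem[OF x RV[of k]] RV[of k]] diff'[of 0 k] \<open>s = 0\<close>
      by (simp add: R0)
    moreover have "(\<lambda>k. 2 * K * P x + N (R k - s)) \<longlonglongrightarrow> 2 * K * P x"
      using tendsto_add[OF tendsto_const s(2)] by simp
    ultimately show ?thesis by (intro LIMSEQ_le_const) auto
  qed
  then show ?thesis using K that[of "2 * K"] by simp
qed

section \<open>Forms inducing an isomorphism onto the conjugate dual\<close>

text \<open>Meant for the difference of \<Omega> \<xi> and an inner product functional, known to
  vanish only on an N-dense set.\<close>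

lemma (in normed_subspace) eq_zero_if_zero_on_dense:
  fixes f :: "'a \<Rightarrow> complex"
  assumes diff: "\<And>x y. x \<in> V \<Longrightarrow> y \<in> V \<Longrightarrow> f (x - y) = f x - f y"
    and bound: "\<And>x. x \<in> V \<Longrightarrow> cmod (f x) \<le> K * N x"
    and dense: "dense_wrt V N S" and zero: "\<And>x. x \<in> S \<Longrightarrow> f x = 0" and x: "x \<in> V"
  shows "f x = 0"
proof (rule ccontr)
  assume fx: "f x \<noteq> 0"
  \<comment> \<open>The divisor is positive for every real \<open>K\<close>, including 0.\<close>
  define e where "e = cmod (f x) / (\<bar>K\<bar> + 1)"
  have "e > 0" using fx by (simp add: e_def)
  then obtain y where y: "y \<in> S" "N (x - y) < e" "y \<in> V"
    using dense x unfolding dense_wrt_iff by blast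
  have "cmod (f x) = cmod (f (x - y))" using diff[OF x y(3)] zero[OF y(1)] by simp
  also have "\<dots> \<le> (\<bar>K\<bar> + 1) * N (x - y)"
    using bound[OF diff_mem[OF x y(3)]] N_nonneg[OF diff_mem[OF x y(3)]]
    by (meson abs_ge_self less_add_one mult_right_mono order.strict_implies_order order_trans)
  also have "\<dots> < (\<bar>K\<bar> + 1) * e" using y(2) by (intro mult_strict_left_mono) auto
  also have "\<dots> = cmod (f x)" by (simp add: e_def)
  finally show False by simp
qed

lemma sesquilinear_on_diff_left:
  assumes "sesquilinear_on V a" "csubspace V" "x \<in> V" "y \<in> V" "z \<in> V"
  shows "a (x - y) z = a x z - a y z"
proof -
  have "(- 1) *\<^sub>C y \<in> V" using assms complex_vector.subspace_scale by blast
  then have "a (x + (- 1) *\<^sub>C y) z = a x z + (- 1) * a y z"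
    using assms unfolding sesquilinear_on_def by metis
  then show ?thesis by simp
qed

lemma sesquilinear_on_diff_right:
  assumes "sesquilinear_on V a" "csubspace V" "x \<in> V" "y \<in> V" "z \<in> V"
  shows "a x (y - z) = a x y - a x z"
proof -
  have "(- 1) *\<^sub>C z \<in> V" using assms complex_vector.subspace_scale by blast
  then have "a x (y + (- 1) *\<^sub>C z) = a x y + cnj (- 1) * a x z"
    using assms unfolding sesquilinear_on_def by metis
  then show ?thesis by simp
qed

text \<open>Isolates what concerns only the Banach space and its conjugate dual: \<open>a\<close>
  will be \<Omega> + \<Upsilon>, and the last two assumptions are the two conditions on a solving
  form.\<close>

locale isomorphic_form = normed_subspace V N
  for V :: "'a::complex_vector set" and N :: "'a \<Rightarrow> real" +
  fixes a :: "'a \<Rightarrow> 'a \<Rightarrow> complex" and \<beta> :: real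
  assumes complete: mcomplete
    and reflexive: "reflexive_wrt V N"
    and sesquilinear: "sesquilinear_on V a"
    and \<beta>_nonneg: "\<beta> \<ge> 0"
    and form_bounded: "\<And>x y. x \<in> V \<Longrightarrow> y \<in> V \<Longrightarrow> cmod (a x y) \<le> \<beta> * N x * N y"
    and form_injective: "\<And>x. x \<in> V \<Longrightarrow> \<forall>y\<in>V. a x y = 0 \<Longrightarrow> x = 0"
    and form_surjective: "\<And>\<Lambda>. \<Lambda> \<in> conj_dual V N \<Longrightarrow> \<exists>x\<in>V. \<forall>y\<in>V. \<Lambda> y = a x y"
begin

lemma a_add_left: "x \<in> V \<Longrightarrow> y \<in> V \<Longrightarrow> z \<in> V \<Longrightarrow> a (x + y) z = a x z + a y z"
  and a_add_right: "x \<in> V \<Longrightarrow> y \<in> V \<Longrightarrow> z \<in> V \<Longrightarrow> a x (y + z) = a x y + a x z"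
  and a_scale_left: "x \<in> V \<Longrightarrow> y \<in> V \<Longrightarrow> a (c *\<^sub>C x) y = c * a x y"
  and a_scale_right: "x \<in> V \<Longrightarrow> y \<in> V \<Longrightarrow> a x (c *\<^sub>C y) = cnj c * a x y"
  using sesquilinear by (auto simp: sesquilinear_on_def)

lemmas a_diff_left = sesquilinear_on_diff_left[OF sesquilinear csubspace_V]

section \<open>The dual norm pulled back along the form\<close>

definition form_norm :: "'a \<Rightarrow> real" where "form_norm x = dual_norm V N (a x)"

lemma form_norm_upper: "x \<in> V \<Longrightarrow> y \<in> V \<Longrightarrow> cmod (a x y) \<le> form_norm x * N y"
  unfolding form_norm_def
  by (rule dual_norm_upper[OF form_bounded[of x]]) (auto simp: a_scale_right norm_mult)

lemma form_norm_least:
  "K \<ge> 0 \<Longrightarrow> (\<And>y. y \<in> V \<Longrightarrow> cmod (a x y) \<le> K * N y) \<Longrightarrow> form_norm x \<le> K"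
  unfolding form_norm_def by (rule dual_norm_le)

lemma form_norm_nonneg: "x \<in> V \<Longrightarrow> 0 \<le> form_norm x"
  unfolding form_norm_def by (rule dual_norm_nonneg[OF form_bounded])

text \<open>Definiteness is injectivity of the form. Homogeneity follows from one inequality,
  applied to a scalar and to its inverse.\<close>

lemma norm_on_form_norm: "norm_on V form_norm"
  unfolding norm_on_def
proof (intro conjI ballI allI)
  fix x assume x: "x \<in> V"
  show "0 \<le> form_norm x" by (rule form_norm_nonneg[OF x])
  show "form_norm x = 0 \<longleftrightarrow> x = 0"
  proof
    assume "form_norm x = 0"
    then have "\<forall>y\<in>V. a x y = 0" using form_norm_upper[OF x] by fastforce
    then show "x = 0" by (rule form_injective[OF x])
  next
    assume "x = 0"
    then have "a x y = 0" if "y \<in> V" for y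
      using a_scale_left[OF zero_mem that, of 0] by simp
    then have "form_norm x \<le> 0" by (intro form_norm_least) auto
    then show "form_norm x = 0" using form_norm_nonneg[OF x] by simp
  qed
  have le: "form_norm (c *\<^sub>C x) \<le> cmod c * form_norm x" if x: "x \<in> V" for c x
  proof (rule form_norm_least)
    show "cmod (a (c *\<^sub>C x) y) \<le> cmod c * form_norm x * N y" if "y \<in> V" for y
      using mult_left_mono[OF form_norm_upper[OF x that], of "cmod c"]
      by (simp add: a_scale_left[OF x that] norm_mult mult.assoc)
  qed (simp add: form_norm_nonneg x)
  show "form_norm (c *\<^sub>C x) = cmod c * form_norm x" for c
  proof (cases "c = 0")
    case True
    then show ?thesis
      using le[OF x, of 0] form_norm_nonneg[OF zero_mem] by simp
  next
    case False
    have "form_norm x \<le> cmod (inverse c) * form_norm (c *\<^sub>C x)"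
      using le[OF scaleC_mem[OF x], of "inverse c" c] False by (simp add: scaleC_scaleC scaleC_one)
    then have "cmod c * form_norm x \<le> form_norm (c *\<^sub>C x)"
      using False by (simp add: norm_inverse norm_divide field_simps)
    with le[OF x, of c] show ?thesis by simp
  qed
  fix y assume y: "y \<in> V"
  show "form_norm (x + y) \<le> form_norm x + form_norm y"
  proof (rule form_norm_least)
    fix z assume z: "z \<in> V"
    have "cmod (a (x + y) z) \<le> cmod (a x z) + cmod (a y z)"
      by (simp add: a_add_left[OF x y z] norm_triangle_ineq)
    also have "\<dots> \<le> (form_norm x + form_norm y) * N z"
      using form_norm_upper[OF x z] form_norm_upper[OF y z] by (simp add: algebra_simps)
    finally show "cmod (a (x + y) z) \<le> (form_norm x + form_norm y) * N z" .
  qed (simp add: form_norm_nonneg x y)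
qed

text \<open>Completeness of the conjugate dual, transported to \<open>V\<close>: the functionals
  \<open>a (\<sigma> n)\<close> converge pointwise to a bounded one, and
  \<open>form_surjective\<close> supplies the vector behind it.\<close>

lemma complete_form_norm: "Metric_space.mcomplete V (norm_dist V form_norm)"
proof -
  interpret P: normed_subspace V form_norm
    by unfold_locales (rule csubspace_V, rule norm_on_form_norm)
  show ?thesis
    unfolding P.mcomplete_def
  proof (intro allI impI)
    fix \<sigma> assume "P.MCauchy \<sigma>"
    then have \<sigma>: "\<And>n. \<sigma> n \<in> V"
      and Cauchy_\<sigma>: "\<And>e. e > 0 \<Longrightarrow> \<exists>n0. \<forall>m n. n0 \<le> m \<longrightarrow> n0 \<le> n \<longrightarrow> form_norm (\<sigma> m - \<sigma> n) < e"
      unfolding P.MCauchy_iff by auto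
    have diff_le: "cmod (a (\<sigma> m) y - a (\<sigma> n) y) \<le> form_norm (\<sigma> m - \<sigma> n) * N y"
      if "y \<in> V" for m n y
      using form_norm_upper[OF diff_mem[OF \<sigma> \<sigma>] that] by (simp add: a_diff_left \<sigma> that)
    have "Cauchy (\<lambda>n. a (\<sigma> n) y)" if y: "y \<in> V" for y
    proof (rule metric_CauchyI)
      fix e :: real assume e: "e > 0"
      have Ny: "N y + 1 > 0" using N_nonneg[OF y] by simp
      obtain n0 where n0: "\<And>m n. n0 \<le> m \<Longrightarrow> n0 \<le> n \<Longrightarrow> form_norm (\<sigma> m - \<sigma> n) < e / (N y + 1)"
        using Cauchy_\<sigma>[of "e / (N y + 1)"] e Ny by auto
      have "dist (a (\<sigma> m) y) (a (\<sigma> n) y) < e" if "n0 \<le> m" "n0 \<le> n" for m n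
      proof -
        have "form_norm (\<sigma> m - \<sigma> n) * N y \<le> form_norm (\<sigma> m - \<sigma> n) * (N y + 1)"
          by (intro mult_left_mono form_norm_nonneg diff_mem \<sigma>) simp
        also have "\<dots> < e" using n0[OF that] Ny by (simp add: field_simps)
        finally show ?thesis using diff_le[OF y, of m n] by (simp add: dist_norm)
      qed
      then show "\<exists>M. \<forall>m\<ge>M. \<forall>n\<ge>M. dist (a (\<sigma> m) y) (a (\<sigma> n) y) < e" by blast
    qed
    then have "\<exists>l. (\<lambda>n. a (\<sigma> n) y) \<longlonglongrightarrow> l" if "y \<in> V" for y
      using that Cauchy_convergent convergent_def by blast
    then obtain L where L: "\<And>y. y \<in> V \<Longrightarrow> (\<lambda>n. a (\<sigma> n) y) \<longlonglongrightarrow> L y" by metis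
    \<comment> \<open>\<open>L\<close> is arbitrary off \<open>V\<close>, where
      \<open>conj_dual\<close> demands the value 0.\<close>
    define \<Lambda> where "\<Lambda> y = (if y \<in> V then L y else 0)" for y
    have lim: "(\<lambda>n. a (\<sigma> n) y) \<longlonglongrightarrow> \<Lambda> y" if "y \<in> V" for y
      using L[OF that] that by (simp add: \<Lambda>_def)
    have "\<Lambda> \<in> conj_dual V N"
      unfolding conj_dual_def
    proof (intro CollectI conjI ballI allI)
      fix x y assume "x \<in> V" "y \<in> V"
      then show "\<Lambda> (x + y) = \<Lambda> x + \<Lambda> y"
        using tendsto_add[OF lim lim, of x y] lim[of "x + y"] LIMSEQ_unique
        by (fastforce simp: a_add_right \<sigma> add_mem)
    next
      fix c x assume "x \<in> V"
      then show "\<Lambda> (c *\<^sub>C x) = cnj c * \<Lambda> x"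
        using tendsto_mult_left[OF lim[of x], of "cnj c"] lim[of "c *\<^sub>C x"] LIMSEQ_unique
        by (fastforce simp: a_scale_right \<sigma> scaleC_mem)
    next
      \<comment> \<open>From n0 on the form norms exceed that of \<open>\<sigma> n0\<close> by at
        most 1, a bound that survives the pointwise limit.\<close>
      obtain n0 where n0: "\<And>n. n0 \<le> n \<Longrightarrow> form_norm (\<sigma> n - \<sigma> n0) < 1"
        using Cauchy_\<sigma>[of 1] by auto
      have "cmod (\<Lambda> y) \<le> (form_norm (\<sigma> n0) + 1) * N y" if y: "y \<in> V" for y
      proof (rule LIMSEQ_le_const2[OF tendsto_norm[OF lim[OF y]]], intro exI allI impI)
        fix n assume "n0 \<le> n"
        then have "form_norm (\<sigma> n) \<le> form_norm (\<sigma> n0) + 1"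
          using P.N_triangle[OF diff_mem[OF \<sigma> \<sigma>] \<sigma>, of n n0 n0] n0[of n] by simp
        then have "form_norm (\<sigma> n) * N y \<le> (form_norm (\<sigma> n0) + 1) * N y"
          by (rule mult_right_mono) (rule N_nonneg[OF y])
        then show "cmod (a (\<sigma> n) y) \<le> (form_norm (\<sigma> n0) + 1) * N y"
          using form_norm_upper[OF \<sigma> y, of n] by linarith
      qed
      then show "\<exists>K. \<forall>x\<in>V. cmod (\<Lambda> x) \<le> K * N x" by blast
    qed (simp add: \<Lambda>_def)
    then obtain x where x: "x \<in> V" and ax: "\<And>y. y \<in> V \<Longrightarrow> \<Lambda> y = a x y"
      using form_surjective by blast
    have "(\<lambda>n. form_norm (\<sigma> n - x)) \<longlonglongrightarrow> 0"
    proof (rule LIMSEQ_I)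
      fix e :: real assume e: "e > 0"
      obtain n0 where n0: "\<And>m n. n0 \<le> m \<Longrightarrow> n0 \<le> n \<Longrightarrow> form_norm (\<sigma> m - \<sigma> n) < e / 2"
        using Cauchy_\<sigma>[of "e / 2"] e by auto
      have "form_norm (\<sigma> n - x) \<le> e / 2" if n: "n0 \<le> n" for n
      proof (rule form_norm_least)
        fix y assume y: "y \<in> V"
        \<comment> \<open>Here n is fixed and m tends to infinity; e / 2 leaves room for the strict
          inequality that is lost in the limit.\<close>
        have "(\<lambda>m. cmod (a (\<sigma> n) y - a (\<sigma> m) y)) \<longlonglongrightarrow> cmod (a (\<sigma> n) y - \<Lambda> y)"
          by (intro tendsto_intros lim y)
        then have "cmod (a (\<sigma> n) y - \<Lambda> y) \<le> e / 2 * N y"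
        proof (rule LIMSEQ_le_const2, intro exI allI impI)
          fix m assume "n0 \<le> m"
          then have "form_norm (\<sigma> n - \<sigma> m) * N y \<le> e / 2 * N y"
            using n0[OF n] N_nonneg[OF y] by (intro mult_right_mono) (auto intro: less_imp_le)
          then show "cmod (a (\<sigma> n) y - a (\<sigma> m) y) \<le> e / 2 * N y"
            using diff_le[OF y, of n m] by linarith
        qed
        then show "cmod (a (\<sigma> n - x) y) \<le> e / 2 * N y"
          by (simp add: a_diff_left \<sigma> x y ax)
      qed (use e in simp)
      then have "norm (form_norm (\<sigma> n - x) - 0) < e" if "n0 \<le> n" for n
        using form_norm_nonneg[OF diff_mem[OF \<sigma> x], of n] e that by fastforce
      then show "\<exists>n0. \<forall>n\<ge>n0. norm (form_norm (\<sigma> n - x) - 0) < e" by blast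
    qed
    with x \<sigma> show "\<exists>x. limitin P.mtopology \<sigma> x sequentially"
      using P.limitin_iff[of \<sigma>] by blast
  qed
qed

text \<open>The inf-sup condition for \<open>a\<close>, that is, boundedness of the inverse of x
  \<mapsto> \<open>a x\<close>. It takes the place of coercivity.\<close>

lemma norm_le_form_norm:
  obtains c where "c \<ge> 0" "\<And>x. x \<in> V \<Longrightarrow> N x \<le> c * form_norm x"
proof (rule complete_norms_equivalent)
  show "normed_subspace V N" by unfold_locales
  show "normed_subspace V form_norm" by unfold_locales (rule csubspace_V, rule norm_on_form_norm)
  show "form_norm x \<le> \<beta> * N x" if "x \<in> V" for x
    using form_bounded[OF that] \<beta>_nonneg N_nonneg[OF that] by (intro form_norm_least) auto
qed (use complete complete_form_norm that in auto)

text \<open>Pulling \<open>f\<close> back along the isomorphism of \<open>V\<close> with its conjugate dual gives an element of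
  the bidual, which reflexivity turns into a vector.\<close>

theorem dual_represented:
  assumes f: "f \<in> dual V N"
  obtains y where "y \<in> V" "\<And>x. x \<in> V \<Longrightarrow> f x = a x y"
proof -
  obtain c where c: "c \<ge> 0" "\<And>x. x \<in> V \<Longrightarrow> N x \<le> c * form_norm x"
    by (rule norm_le_form_norm) blast
  have f_add: "\<And>x y. x \<in> V \<Longrightarrow> y \<in> V \<Longrightarrow> f (x + y) = f x + f y"
    and f_scale: "\<And>c x. x \<in> V \<Longrightarrow> f (c *\<^sub>C x) = c * f x"
    using f by (auto simp: dual_def)
  obtain K where K: "\<And>x. x \<in> V \<Longrightarrow> cmod (f x) \<le> K * N x"
    using f unfolding dual_def by blast
  \<comment> \<open>Conjugation carries the dual to the conjugate dual, where the form can be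
    inverted; the resulting \<open>R\<close> is conjugate linear.\<close>
  have "\<exists>x\<in>V. \<forall>y\<in>V. cnj (g y) = a x y" if "g \<in> dual V N" for g
    using that by (intro form_surjective) (auto simp: dual_def conj_dual_def)
  then obtain R where R: "\<And>g. g \<in> dual V N \<Longrightarrow> R g \<in> V"
    and aR: "\<And>g y. g \<in> dual V N \<Longrightarrow> y \<in> V \<Longrightarrow> a (R g) y = cnj (g y)" by metis
  have R_eq: "R g = x" if "g \<in> dual V N" "x \<in> V" "\<And>y. y \<in> V \<Longrightarrow> a x y = cnj (g y)" for g x
  proof -
    have "\<forall>y\<in>V. a (R g - x) y = 0" using that R aR by (simp add: a_diff_left)
    then show ?thesis using form_injective[of "R g - x"] that R diff_mem by simp
  qed
  have add_dual: "(\<lambda>x. g x + h x) \<in> dual V N" if g: "g \<in> dual V N" and h: "h \<in> dual V N" for g h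
  proof -
    obtain K1 K2 where "\<forall>x\<in>V. cmod (g x) \<le> K1 * N x" "\<forall>x\<in>V. cmod (h x) \<le> K2 * N x"
      using g h by (auto simp: dual_def)
    then have "\<forall>x\<in>V. cmod (g x + h x) \<le> (K1 + K2) * N x"
      by (auto simp: distrib_right intro!: order_trans[OF norm_triangle_ineq] add_mono)
    moreover have "\<forall>x\<in>V. \<forall>y\<in>V. g (x + y) + h (x + y) = g x + h x + (g y + h y)"
      "\<forall>c. \<forall>x\<in>V. g (c *\<^sub>C x) + h (c *\<^sub>C x) = c * (g x + h x)"
      "\<forall>x. x \<notin> V \<longrightarrow> g x + h x = 0"
      using g h by (auto simp: dual_def algebra_simps)
    ultimately show ?thesis by (auto simp: dual_def)
  qed
  have scale_dual: "(\<lambda>x. d * g x) \<in> dual V N" if g: "g \<in> dual V N" for d g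
  proof -
    obtain K1 where "\<forall>x\<in>V. cmod (g x) \<le> K1 * N x" using g by (auto simp: dual_def)
    then have "\<forall>x\<in>V. cmod (d * g x) \<le> (cmod d * K1) * N x"
      by (auto simp: norm_mult mult.assoc intro!: mult_left_mono)
    moreover have "\<forall>x\<in>V. \<forall>y\<in>V. d * g (x + y) = d * g x + d * g y"
      "\<forall>c. \<forall>x\<in>V. d * g (c *\<^sub>C x) = c * (d * g x)" "\<forall>x. x \<notin> V \<longrightarrow> d * g x = 0"
      using g by (auto simp: dual_def algebra_simps)
    ultimately show ?thesis unfolding dual_def by blast
  qed
  \<comment> \<open>The outer conjugation compensates for that of \<open>R\<close> and makes
    \<open>F\<close> linear.\<close>
  define F where "F g = cnj (f (R g))" for g
  have "F \<in> bidual V N"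
    unfolding bidual_def
  proof (intro CollectI conjI ballI allI)
    fix g h assume g: "g \<in> dual V N" and h: "h \<in> dual V N"
    have "R (\<lambda>x. g x + h x) = R g + R h"
      by (intro R_eq add_dual g h add_mem R) (simp add: a_add_left R aR g h)
    then show "F (\<lambda>x. g x + h x) = F g + F h" by (simp add: F_def f_add R g h)
  next
    fix d g assume g: "g \<in> dual V N"
    have "R (\<lambda>x. d * g x) = cnj d *\<^sub>C R g"
      by (intro R_eq scale_dual g scaleC_mem R) (simp add: a_scale_left R aR g)
    then show "F (\<lambda>x. d * g x) = d * F g" by (simp add: F_def f_scale R g)
  next
    have "cmod (F g) \<le> (\<bar>K\<bar> * c) * dual_norm V N g" if g: "g \<in> dual V N" for g
    proof -
      \<comment> \<open>\<open>a (R g)\<close> and \<open>g\<close> have the same modulus on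
        \<open>V\<close>.\<close>
      have "form_norm (R g) = dual_norm V N g"
        unfolding form_norm_def dual_norm_def using g by (intro SUP_cong) (auto simp: aR)
      then have "\<bar>K\<bar> * N (R g) \<le> \<bar>K\<bar> * (c * dual_norm V N g)"
        using c(2)[OF R[OF g]] by (intro mult_left_mono) auto
      moreover have "cmod (F g) \<le> \<bar>K\<bar> * N (R g)"
        using K[OF R[OF g]] mult_right_mono[OF abs_ge_self N_nonneg[OF R[OF g]], of K]
        by (simp add: F_def)
      ultimately show ?thesis by (simp add: mult.assoc)
    qed
    then show "\<exists>K. \<forall>f\<in>dual V N. cmod (F f) \<le> K * dual_norm V N f" by blast
  qed
  then obtain y where y: "y \<in> V" and Fy: "\<And>g. g \<in> dual V N \<Longrightarrow> F g = g y"
    using reflexive by (auto simp: reflexive_wrt_def)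
  have "f x = a x y" if x: "x \<in> V" for x
  proof -
    \<comment> \<open>Chosen so that \<open>R g\<close> is \<open>x\<close>; then
      \<open>F g = g y\<close> is the conjugate of the claim.\<close>
    define g where "g z = (if z \<in> V then cnj (a x z) else 0)" for z
    have g: "g \<in> dual V N"
      using form_norm_upper[OF x] x unfolding dual_def
      by (auto simp: g_def a_add_right a_scale_right add_mem scaleC_mem)
    have "R g = x" by (rule R_eq[OF g x]) (simp add: g_def)
    then show ?thesis using Fy[OF g] y by (simp add: F_def g_def)
  qed
  with y show ?thesis using that by blast
qed

end

section \<open>Operators\<close>

lemma operator_eqI:
  assumes "\<And>x y u v. A x = Some u \<Longrightarrow> A y = Some v \<Longrightarrow> A (x + y) = Some (u + v)"
    and "\<And>c x u. A x = Some u \<Longrightarrow> A (c *\<^sub>C x) = Some (c *\<^sub>C u)"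
    and "A 0 = Some 0"
  shows "operator A"
  unfolding operator_def complex_vector.subspace_def
  using assms by (fastforce simp: dom_def)

lemma operator_Some:
  assumes "operator A"
  shows operator_add: "A x = Some u \<Longrightarrow> A y = Some v \<Longrightarrow> A (x + y) = Some (u + v)"
    and operator_scale: "A x = Some u \<Longrightarrow> A (c *\<^sub>C x) = Some (c *\<^sub>C u)"
    and operator_zero: "A 0 = Some 0"
proof -
  have sub: "csubspace (dom A)"
    and add: "\<And>x y. x \<in> dom A \<Longrightarrow> y \<in> dom A \<Longrightarrow> the (A (x + y)) = the (A x) + the (A y)"
    and scale: "\<And>c x. x \<in> dom A \<Longrightarrow> the (A (c *\<^sub>C x)) = c *\<^sub>C the (A x)"
    using assms by (auto simp: operator_def)
  have Some: "A x = Some (the (A x))" if "x \<in> dom A" for x using that by auto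
  show "A (x + y) = Some (u + v)" if "A x = Some u" "A y = Some v"
    using Some[OF complex_vector.subspace_add[OF sub], of x y] add[of x y] that by (auto simp: dom_def)
  show sc: "A (c *\<^sub>C x) = Some (c *\<^sub>C u)" if "A x = Some u" for c x u
    using Some[OF complex_vector.subspace_scale[OF sub], of x c] scale[of x c] that
    by (auto simp: dom_def)
  show "A 0 = Some 0"
    using sc[OF Some[OF complex_vector.subspace_0[OF sub]], of 0] by simp
qed

lemma operator_diff: "operator A \<Longrightarrow> A x = Some u \<Longrightarrow> A y = Some v \<Longrightarrow> A (x - y) = Some (u - v)"
  using operator_add[of A x u "- y" "- v"] operator_scale[of A y v "- 1"] by simp

lemma op_add_eq_Some:
  "op_add S T x = Some w \<longleftrightarrow> (\<exists>u v. S x = Some u \<and> T x = Some v \<and> w = u + v)"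
  by (auto simp: op_add_def)

lemma operator_op_add: "operator S \<Longrightarrow> operator T \<Longrightarrow> operator (op_add S T)"
  by (rule operator_eqI)
    (auto simp: op_add_eq_Some operator_Some scaleC_add_right intro: add.assoc)

lemma op_inverse_eq_Some:
  assumes "op_invertible A"
  shows "op_inverse A y = Some x \<longleftrightarrow> A x = Some y"
proof -
  have uniq: "x' = x''" if "A x' = Some y" "A x'' = Some y" for x' x''
    using assms that by (auto simp: op_invertible_def inj_on_def dom_def)
  then have "(THE x. A x = Some y) = x'" if "A x' = Some y" for x'
    using that by blast
  then show ?thesis by (auto simp: op_inverse_def ran_def)
qed

lemma op_inverse_in_bounded_ops:
  assumes A: "operator A" and inj: "op_invertible A" and ran: "ran A = UNIV"
    and bound: "\<And>x y. A x = Some y \<Longrightarrow> norm x \<le> C * norm y"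
  shows "op_inverse A \<in> bounded_ops"
proof -
  note inv = op_inverse_eq_Some[OF inj]
  have dom: "dom (op_inverse A) = UNIV" using ran by (auto simp: op_inverse_def)
  have "operator (op_inverse A)"
    by (rule operator_eqI) (auto simp: inv operator_Some[OF A])
  moreover have "norm (the (op_inverse A y)) \<le> C * norm y" for y
    using dom inv bound by (metis UNIV_I domD option.sel)
  ultimately show ?thesis using dom by (auto simp: bounded_ops_def)
qed

lemma bounded_ops_total:
  assumes "B \<in> bounded_ops"
  obtains b K where "\<And>x. B x = Some (b x)" "\<And>x y. b (x - y) = b x - b y"
    "\<And>x. norm (b x) \<le> K * norm x"
proof -
  obtain K where op: "operator B" and dom: "dom B = UNIV"
    and K: "\<And>x. norm (the (B x)) \<le> K * norm x"
    using assms unfolding bounded_ops_def by blast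
  have Some: "B x = Some (the (B x))" for x using dom by (metis UNIV_I domD option.sel)
  have "the (B (x - y)) = the (B x) - the (B y)" for x y
    using operator_diff[OF op Some Some, of x y] by simp
  from that[OF Some this K] show ?thesis .
qed

lemma op_scalar_bounded: "op_scalar c \<in> (bounded_ops :: ('a::complex_hilbert \<rightharpoonup> 'a) set)"
proof -
  have "operator (op_scalar c :: 'a \<rightharpoonup> 'a)"
    by (rule operator_eqI) (auto simp: op_scalar_def scaleC_add_right scaleC_scaleC mult.commute)
  then show ?thesis by (auto simp: bounded_ops_def op_scalar_def dom_def norm_scaleC intro!: exI[of _ "cmod c"])
qed

text \<open>Riesz for each first argument separately; uniqueness of the representing vector makes it
  depend linearly on that argument. This supplies an operator for at least one solving form.\<close>

lemma bounded_form_represented: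
  assumes "bounded_form \<Upsilon>"
  obtains B where "B \<in> bounded_ops" "represents_on B \<Upsilon> UNIV"
proof -
  obtain K0 where sesq: "sesquilinear_on UNIV \<Upsilon>"
    and K0: "\<And>x y. cmod (\<Upsilon> x y) \<le> K0 * norm x * norm y"
    using assms unfolding bounded_form_def by blast
  have "\<exists>z. \<forall>y. \<Upsilon> x y = cinner z y" for x
  proof (rule Riesz_representation[of "\<Upsilon> x" "K0 * norm x"])
    show "\<Upsilon> x (y + z) = \<Upsilon> x y + \<Upsilon> x z" "\<Upsilon> x (c *\<^sub>C y) = cnj c * \<Upsilon> x y" for y z c
      using sesq by (simp_all add: sesquilinear_on_def)
  qed (use K0 in auto)
  then obtain b where b: "\<And>x y. \<Upsilon> x y = cinner (b x) y" by metis
  have eqI: "u = v" if "\<And>y. cinner u y = cinner v y" for u v :: 'a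
    by (rule cinner_eq_on_dense[of UNIV]) (use that in auto)
  have add: "b (x + y) = b x + b y" for x y
    using sesq by (intro eqI) (simp add: b[symmetric] cinner_add_left sesquilinear_on_def)
  have scale: "b (c *\<^sub>C x) = c *\<^sub>C b x" for c x
    using sesq by (intro eqI) (simp add: b[symmetric] cinner_scaleC_left sesquilinear_on_def)
  have "norm (b x) \<le> K0 * norm x" for x
  proof (cases "b x = 0")
    case True
    show ?thesis
    proof (cases "x = 0")
      case False
      \<comment> \<open>\<open>K0\<close> carries no sign; the bound on the diagonal shows that it
        is nonnegative once there is a nonzero \<open>x\<close>.\<close>
      have "0 \<le> K0 * norm x * norm x" using K0[of x x] norm_ge_zero order_trans by blast
      then show ?thesis using True False by (simp add: zero_le_mult_iff)
    qed (use True in auto)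
  next
    case False
    have "norm (b x) * norm (b x) \<le> K0 * norm x * norm (b x)"
      using K0[of x "b x"] by (simp add: b cinner_self norm_power power2_eq_square norm_mult)
    then show ?thesis using False by simp
  qed
  moreover have "operator (\<lambda>x. Some (b x))"
    using scale[of 0 0] by (intro operator_eqI) (auto simp: add scale)
  ultimately have "(\<lambda>x. Some (b x)) \<in> bounded_ops"
    by (auto simp: bounded_ops_def dom_def)
  moreover have "represents_on (\<lambda>x. Some (b x)) \<Upsilon> UNIV"
    by (simp add: represents_on_def b)
  ultimately show ?thesis using that by blast
qed

section \<open>The operator associated with a solvable form\<close>

text \<open>By Riesz, the domain consists of all \<xi> in \<open>D\<close> for which \<Omega> \<xi>
  extends to a bounded functional on H. For dense \<open>D\<close> the chosen vector is
  unique.\<close>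

definition form_operator ::
  "'a::complex_hilbert set \<Rightarrow> ('a \<Rightarrow> 'a \<Rightarrow> complex) \<Rightarrow> ('a \<rightharpoonup> 'a)" where
  "form_operator D \<Omega> = (\<lambda>\<xi>. if \<xi> \<in> D \<and> (\<exists>\<psi>. \<forall>\<eta>\<in>D. \<Omega> \<xi> \<eta> = cinner \<psi> \<eta>)
     then Some (SOME \<psi>. \<forall>\<eta>\<in>D. \<Omega> \<xi> \<eta> = cinner \<psi> \<eta>) else None)"

lemma form_operator_eq_Some:
  assumes "closure D = UNIV"
  shows "form_operator D \<Omega> \<xi> = Some \<psi> \<longleftrightarrow> \<xi> \<in> D \<and> (\<forall>\<eta>\<in>D. \<Omega> \<xi> \<eta> = cinner \<psi> \<eta>)"
proof -
  have "(SOME \<psi>. \<forall>\<eta>\<in>D. \<Omega> \<xi> \<eta> = cinner \<psi> \<eta>) = \<psi>" if \<psi>: "\<forall>\<eta>\<in>D. \<Omega> \<xi> \<eta> = cinner \<psi> \<eta>" for \<psi>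
    using \<psi>
  proof (rule some_equality)
    show "\<psi>' = \<psi>" if "\<forall>\<eta>\<in>D. \<Omega> \<xi> \<eta> = cinner \<psi>' \<eta>" for \<psi>'
      using cinner_eq_on_dense[OF assms, of \<psi>' \<psi>] that \<psi> by auto
  qed
  then show ?thesis by (auto simp: form_operator_def)
qed

locale solvable_form =
  fixes D :: "'a::complex_hilbert set"
    and \<Omega> :: "'a \<Rightarrow> 'a \<Rightarrow> complex"
    and N :: "'a \<Rightarrow> real"
  assumes csubspace_D: "csubspace D" and dense_D: "closure D = UNIV"
    and sesquilinear_\<Omega>: "sesquilinear_on D \<Omega>"
    and norm_on_D: "norm_on D N"
    and solvable: "solvable D \<Omega> N"
begin

sublocale normed_subspace D N
  by unfold_locales (rule csubspace_D, rule norm_on_D)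

abbreviation T :: "'a \<rightharpoonup> 'a" where "T \<equiv> form_operator D \<Omega>"

lemmas T_eq_Some = form_operator_eq_Some[OF dense_D, of \<Omega>]

lemma dom_T: "dom T \<subseteq> D"
  by (auto simp: T_eq_Some)

lemma represents_T: "represents_on T \<Omega> D"
  unfolding represents_on_def
proof (intro ballI)
  fix \<xi> \<eta> assume "\<xi> \<in> dom T" "\<eta> \<in> D"
  then obtain \<psi> where \<psi>: "T \<xi> = Some \<psi>" by blast
  with \<open>\<eta> \<in> D\<close> show "\<Omega> \<xi> \<eta> = cinner (the (T \<xi>)) \<eta>"
    using T_eq_Some[of \<xi> \<psi>] by simp
qed

lemma operator_T: "operator T"
proof (rule operator_eqI)
  fix x y u v assume "T x = Some u" "T y = Some v"
  then show "T (x + y) = Some (u + v)"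
    using sesquilinear_\<Omega> by (simp add: T_eq_Some add_mem sesquilinear_on_def cinner_add_left)
next
  have sc: "T (c *\<^sub>C x) = Some (c *\<^sub>C u)" if "T x = Some u" for c x u
    using that sesquilinear_\<Omega> by (simp add: T_eq_Some scaleC_mem sesquilinear_on_def cinner_scaleC_left)
  then show "T x = Some u \<Longrightarrow> T (c *\<^sub>C x) = Some (c *\<^sub>C u)" for c x u .
  have "\<Omega> 0 \<eta> = 0" if "\<eta> \<in> D" for \<eta>
    using sesquilinear_on_diff_left[OF sesquilinear_\<Omega> csubspace_D zero_mem zero_mem that] by simp
  then show "T 0 = Some 0" by (simp add: T_eq_Some zero_mem)
qed

lemma norm_le_N:
  obtains \<alpha> where "\<alpha> > 0" "\<And>\<xi>. \<xi> \<in> D \<Longrightarrow> norm \<xi> \<le> \<alpha> * N \<xi>"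
  using solvable unfolding solvable_def q_closed_def by blast

lemma \<Omega>_bounded:
  obtains \<beta> where "\<beta> > 0" "\<And>\<xi> \<eta>. \<xi> \<in> D \<Longrightarrow> \<eta> \<in> D \<Longrightarrow> cmod (\<Omega> \<xi> \<eta>) \<le> \<beta> * N \<xi> * N \<eta>"
  using solvable unfolding solvable_def q_closed_def by blast

text \<open>In the second variable \<Omega> is N-bounded by q-closedness, and so is the inner
  product since norm \<le> \<alpha> N. The identity therefore extends from \<open>S\<close> to
  \<open>D\<close>, where it characterises \<open>T\<close>.\<close>

lemma T_maximal:
  assumes "operator T'" "dom T' \<subseteq> D" "dense_wrt D N S" "represents_on T' \<Omega> S"
  shows "T' \<subseteq>\<^sub>m T"
  unfolding map_le_def
proof
  fix \<xi> assume \<xi>: "\<xi> \<in> dom T'"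
  then obtain \<psi> where \<psi>: "T' \<xi> = Some \<psi>" by blast
  have \<xi>D: "\<xi> \<in> D" using \<xi> assms(2) by blast
  obtain \<alpha> where \<alpha>: "\<alpha> > 0" "\<And>\<xi>. \<xi> \<in> D \<Longrightarrow> norm \<xi> \<le> \<alpha> * N \<xi>"
    by (rule norm_le_N) blast
  obtain \<beta> where \<beta>: "\<beta> > 0" "\<And>\<xi> \<eta>. \<xi> \<in> D \<Longrightarrow> \<eta> \<in> D \<Longrightarrow> cmod (\<Omega> \<xi> \<eta>) \<le> \<beta> * N \<xi> * N \<eta>"
    by (rule \<Omega>_bounded) blast
  have "\<Omega> \<xi> \<eta> - cinner \<psi> \<eta> = 0" if "\<eta> \<in> D" for \<eta>
  proof (rule eq_zero_if_zero_on_dense[OF _ _ assms(3) _ that])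
    show "\<Omega> \<xi> (x - y) - cinner \<psi> (x - y) = \<Omega> \<xi> x - cinner \<psi> x - (\<Omega> \<xi> y - cinner \<psi> y)"
      if "x \<in> D" "y \<in> D" for x y
      by (simp add: sesquilinear_on_diff_right[OF sesquilinear_\<Omega> csubspace_D \<xi>D that] cinner_diff_right)
    show "cmod (\<Omega> \<xi> x - cinner \<psi> x) \<le> (\<beta> * N \<xi> + norm \<psi> * \<alpha>) * N x" if x: "x \<in> D" for x
    proof -
      have "cmod (cinner \<psi> x) \<le> norm \<psi> * (\<alpha> * N x)"
        using cinner_Cauchy_Schwarz[of \<psi> x] mult_left_mono[OF \<alpha>(2)[OF x], of "norm \<psi>"] by simp
      then show ?thesis
        using norm_triangle_ineq4[of "\<Omega> \<xi> x" "cinner \<psi> x"] \<beta>(2)[OF \<xi>D x]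
        by (simp add: algebra_simps)
    qed
    show "\<Omega> \<xi> x - cinner \<psi> x = 0" if "x \<in> S" for x
      using assms(4) \<xi> \<psi> that by (auto simp: represents_on_def)
  qed
  then show "T' \<xi> = T \<xi>"
    using \<psi> \<xi>D T_eq_Some[of \<xi> \<psi>] by simp
qed

lemma isomorphic_form_perturbed:
  assumes "\<Upsilon> \<in> solving_forms D \<Omega> N"
  obtains \<beta> where "isomorphic_form D N (\<lambda>\<xi> \<eta>. \<Omega> \<xi> \<eta> + \<Upsilon> \<xi> \<eta>) \<beta>"
proof -
  obtain \<alpha> where \<alpha>: "\<alpha> > 0" "\<And>\<xi>. \<xi> \<in> D \<Longrightarrow> norm \<xi> \<le> \<alpha> * N \<xi>"
    by (rule norm_le_N) blast
  obtain \<beta> where \<beta>: "\<beta> > 0" "\<And>\<xi> \<eta>. \<xi> \<in> D \<Longrightarrow> \<eta> \<in> D \<Longrightarrow> cmod (\<Omega> \<xi> \<eta>) \<le> \<beta> * N \<xi> * N \<eta>"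
    by (rule \<Omega>_bounded) blast
  obtain K where sesq: "sesquilinear_on UNIV \<Upsilon>"
    and K: "\<And>x y. cmod (\<Upsilon> x y) \<le> K * norm x * norm y"
    using assms unfolding solving_forms_def bounded_form_def by blast
  \<comment> \<open>The bound for \<Upsilon> is one in the norm of H; each of its two arguments
    costs a factor \<alpha> when passing to \<open>N\<close>.\<close>
  have "isomorphic_form D N (\<lambda>\<xi> \<eta>. \<Omega> \<xi> \<eta> + \<Upsilon> \<xi> \<eta>) (\<beta> + \<bar>K\<bar> * \<alpha> * \<alpha>)"
  proof
    show mcomplete and "reflexive_wrt D N"
      using solvable by (auto simp: solvable_def q_closed_def)
    show "sesquilinear_on D (\<lambda>\<xi> \<eta>. \<Omega> \<xi> \<eta> + \<Upsilon> \<xi> \<eta>)"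
      using sesq sesquilinear_\<Omega> by (auto simp: sesquilinear_on_def algebra_simps)
    show "0 \<le> \<beta> + \<bar>K\<bar> * \<alpha> * \<alpha>" using \<alpha> \<beta> by simp
    show "cmod (\<Omega> x y + \<Upsilon> x y) \<le> (\<beta> + \<bar>K\<bar> * \<alpha> * \<alpha>) * N x * N y" if "x \<in> D" "y \<in> D" for x y
    proof -
      have "K * norm x * norm y \<le> \<bar>K\<bar> * (\<alpha> * N x) * (\<alpha> * N y)"
        using \<alpha> that N_nonneg by (intro mult_mono) auto
      then show ?thesis
        using norm_triangle_ineq[of "\<Omega> x y" "\<Upsilon> x y"] \<beta>(2)[OF that] K[of x y]
        by (simp add: algebra_simps)
    qed
  qed (use assms in \<open>auto simp: solving_forms_def\<close>)
  then show ?thesis by (rule that)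
qed

section \<open>The perturbed operator T + B for one solving form\<close>

context
  fixes \<Upsilon> B
  assumes \<Upsilon>: "\<Upsilon> \<in> solving_forms D \<Omega> N" and B: "B \<in> bounded_ops"
    and B_\<Upsilon>: "represents_on B \<Upsilon> UNIV"
begin

text \<open>As \<open>B\<close> is defined everywhere, T + B is the maximal operator of \<Omega> +
  \<Upsilon>; both conditions on a solving form can thus be read as statements about T + B.\<close>

lemma T_plus_B_eq_Some:
  "op_add T B \<xi> = Some \<psi> \<longleftrightarrow> \<xi> \<in> D \<and> (\<forall>\<eta>\<in>D. \<Omega> \<xi> \<eta> + \<Upsilon> \<xi> \<eta> = cinner \<psi> \<eta>)"
proof -
  obtain b where b: "\<And>x. B x = Some (b x)" by (rule bounded_ops_total[OF B]) blast
  have "\<Upsilon> \<xi> \<eta> = cinner (b \<xi>) \<eta>" for \<eta>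
    using B_\<Upsilon> b by (auto simp: represents_on_def dom_def)
  moreover have "op_add T B \<xi> = Some \<psi> \<longleftrightarrow> T \<xi> = Some (\<psi> - b \<xi>)"
    by (auto simp: op_add_eq_Some b)
  ultimately show ?thesis by (simp add: T_eq_Some cinner_diff_left eq_diff_eq)
qed

lemma operator_T_plus_B: "operator (op_add T B)"
  using operator_T B by (auto simp: bounded_ops_def intro: operator_op_add)

lemma invertible_T_plus_B: "op_invertible (op_add T B)"
  unfolding op_invertible_def
proof (rule inj_onI)
  fix x y assume "x \<in> dom (op_add T B)" and eq: "op_add T B x = op_add T B y"
  then obtain u where "op_add T B x = Some u" by blast
  then have "op_add T B (x - y) = Some 0"
    using operator_diff[OF operator_T_plus_B, of x u y u] eq by simp
  then have "x - y \<in> D" "\<forall>\<eta>\<in>D. \<Omega> (x - y) \<eta> + \<Upsilon> (x - y) \<eta> = 0"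
    by (simp_all add: T_plus_B_eq_Some)
  then have "x - y = 0" using \<Upsilon> by (auto simp: solving_forms_def)
  then show "x = y" by simp
qed

text \<open>Since norm \<le> \<alpha> N, every \<psi> in H induces on \<open>D\<close> an element of
  the conjugate dual, and \<Upsilon> solves the equation for it.\<close>

lemma T_plus_B_surj: obtains \<xi> where "op_add T B \<xi> = Some \<psi>"
proof -
  obtain \<alpha> where \<alpha>: "\<alpha> > 0" "\<And>\<xi>. \<xi> \<in> D \<Longrightarrow> norm \<xi> \<le> \<alpha> * N \<xi>"
    by (rule norm_le_N) blast
  define \<Lambda> where "\<Lambda> \<eta> = (if \<eta> \<in> D then cinner \<psi> \<eta> else 0)" for \<eta>
  have "cmod (cinner \<psi> x) \<le> (norm \<psi> * \<alpha>) * N x" if "x \<in> D" for x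
    using cinner_Cauchy_Schwarz[of \<psi> x] mult_left_mono[OF \<alpha>(2)[OF that], of "norm \<psi>"]
    by (simp add: mult.assoc)
  then have "\<Lambda> \<in> conj_dual D N"
    unfolding conj_dual_def
    by (auto simp: \<Lambda>_def add_mem scaleC_mem cinner_add_right cinner_scaleC_right)
  then obtain \<xi> where "\<xi> \<in> D" "\<forall>\<eta>\<in>D. \<Lambda> \<eta> = \<Omega> \<xi> \<eta> + \<Upsilon> \<xi> \<eta>"
    using \<Upsilon> by (auto simp: solving_forms_def)
  then show ?thesis using that[of \<xi>] by (simp add: T_plus_B_eq_Some \<Lambda>_def)
qed

lemma ran_T_plus_B: "ran (op_add T B) = UNIV"
  unfolding ran_def using T_plus_B_surj by blast

text \<open>The constant is \<alpha> c \<alpha>: one \<alpha> for the embedding of E in H, c for the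
  inverse of the form, one \<alpha> for the embedding of H in the conjugate dual.\<close>

lemma T_plus_B_bounded_below:
  obtains C where "\<And>\<xi> \<psi>. op_add T B \<xi> = Some \<psi> \<Longrightarrow> norm \<xi> \<le> C * norm \<psi>"
proof -
  obtain \<alpha> where \<alpha>: "\<alpha> > 0" "\<And>\<xi>. \<xi> \<in> D \<Longrightarrow> norm \<xi> \<le> \<alpha> * N \<xi>"
    by (rule norm_le_N) blast
  obtain \<beta> where "isomorphic_form D N (\<lambda>\<xi> \<eta>. \<Omega> \<xi> \<eta> + \<Upsilon> \<xi> \<eta>) \<beta>"
    by (rule isomorphic_form_perturbed[OF \<Upsilon>])
  then interpret iso: isomorphic_form D N "\<lambda>\<xi> \<eta>. \<Omega> \<xi> \<eta> + \<Upsilon> \<xi> \<eta>" \<beta> .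
  obtain c where c: "c \<ge> 0" "\<And>x. x \<in> D \<Longrightarrow> N x \<le> c * iso.form_norm x"
    by (rule iso.norm_le_form_norm) blast
  show ?thesis
  proof (rule that[of "\<alpha> * c * \<alpha>"])
    fix \<xi> \<psi> assume *: "op_add T B \<xi> = Some \<psi>"
    then have \<xi>: "\<xi> \<in> D" and eq: "\<And>\<eta>. \<eta> \<in> D \<Longrightarrow> \<Omega> \<xi> \<eta> + \<Upsilon> \<xi> \<eta> = cinner \<psi> \<eta>"
      by (simp_all add: T_plus_B_eq_Some)
    have "iso.form_norm \<xi> \<le> \<alpha> * norm \<psi>"
    proof (rule iso.form_norm_least)
      show "cmod (\<Omega> \<xi> y + \<Upsilon> \<xi> y) \<le> \<alpha> * norm \<psi> * N y" if "y \<in> D" for y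
        using cinner_Cauchy_Schwarz[of \<psi> y] mult_left_mono[OF \<alpha>(2)[OF that], of "norm \<psi>"]
        by (simp add: eq[OF that] mult_ac)
    qed (use \<alpha> in simp)
    then have "c * iso.form_norm \<xi> \<le> c * (\<alpha> * norm \<psi>)" using c(1) by (rule mult_left_mono)
    then have "\<alpha> * N \<xi> \<le> \<alpha> * (c * (\<alpha> * norm \<psi>))"
      using c(2)[OF \<xi>] \<alpha>(1) by (intro mult_left_mono) auto
    then show "norm \<xi> \<le> \<alpha> * c * \<alpha> * norm \<psi>" using \<alpha>(2)[OF \<xi>] by (simp add: mult_ac)
  qed
qed

lemma inverse_T_plus_B: "op_inverse (op_add T B) \<in> bounded_ops"
proof -
  obtain C where C: "\<And>\<xi> \<psi>. op_add T B \<xi> = Some \<psi> \<Longrightarrow> norm \<xi> \<le> C * norm \<psi>"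
    by (rule T_plus_B_bounded_below) blast
  show ?thesis
    by (rule op_inverse_in_bounded_ops[OF operator_T_plus_B invertible_T_plus_B ran_T_plus_B C])
qed

text \<open>For a limit (x, y) of points of the graph, solve (T + B) \<zeta> = y + B x. The lower
  bound for T + B forces the first components to converge to \<zeta>, so \<zeta> = x.\<close>

lemma closed_graph_T: "closed (Map.graph T)"
  unfolding closed_sequential_limits
proof (intro allI impI, elim conjE)
  fix X l assume X: "\<forall>n. X n \<in> Map.graph T" and lim: "X \<longlonglongrightarrow> l"
  obtain C where C: "\<And>\<xi> \<psi>. op_add T B \<xi> = Some \<psi> \<Longrightarrow> norm \<xi> \<le> C * norm \<psi>"
    by (rule T_plus_B_bounded_below) blast
  obtain b K where b: "\<And>x. B x = Some (b x)" and b_diff: "\<And>x y. b (x - y) = b x - b y"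
    and K: "\<And>x. norm (b x) \<le> K * norm x"
    by (rule bounded_ops_total[OF B]) blast
  define x y where "x = fst l" and "y = snd l"
  define \<xi> \<psi> where "\<xi> n = fst (X n)" and "\<psi> n = snd (X n)" for n
  have T\<xi>: "T (\<xi> n) = Some (\<psi> n)" for n
    using X by (auto simp: \<xi>_def \<psi>_def in_graphD)
  have lim\<xi>: "\<xi> \<longlonglongrightarrow> x" and lim\<psi>: "\<psi> \<longlonglongrightarrow> y"
    using tendsto_fst[OF lim] tendsto_snd[OF lim] by (simp_all add: \<xi>_def[abs_def] \<psi>_def[abs_def] x_def y_def)
  have "(\<lambda>n. b (\<xi> n) - b x) \<longlonglongrightarrow> 0"
  proof (rule Lim_null_comparison)
    show "\<forall>\<^sub>F n in sequentially. norm (b (\<xi> n) - b x) \<le> K * norm (\<xi> n - x)"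
      using K[of "\<xi> _ - x"] by (simp add: b_diff)
    show "(\<lambda>n. K * norm (\<xi> n - x)) \<longlonglongrightarrow> 0"
      using lim\<xi> by (intro tendsto_mult_right_zero tendsto_norm_zero LIM_zero)
  qed
  then have lim_sum: "(\<lambda>n. (\<psi> n - y) + (b (\<xi> n) - b x)) \<longlonglongrightarrow> 0"
    using tendsto_add[OF LIM_zero[OF lim\<psi>]] by fastforce
  obtain \<zeta> where \<zeta>: "op_add T B \<zeta> = Some (y + b x)"
    by (rule T_plus_B_surj)
  have "op_add T B (\<xi> n) = Some (\<psi> n + b (\<xi> n))" for n
    by (simp add: op_add_eq_Some T\<xi> b)
  then have "norm (\<xi> n - \<zeta>) \<le> C * norm ((\<psi> n + b (\<xi> n)) - (y + b x))" for n
    by (intro C operator_diff[OF operator_T_plus_B] \<zeta>)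
  then have "\<forall>\<^sub>F n in sequentially. norm (\<xi> n - \<zeta>) \<le> C * norm ((\<psi> n - y) + (b (\<xi> n) - b x))"
    by (simp add: algebra_simps)
  moreover have "(\<lambda>n. C * norm ((\<psi> n - y) + (b (\<xi> n) - b x))) \<longlonglongrightarrow> 0"
    by (intro tendsto_mult_right_zero tendsto_norm_zero lim_sum)
  ultimately have "(\<lambda>n. \<xi> n - \<zeta>) \<longlonglongrightarrow> 0" by (rule Lim_null_comparison)
  then have "\<xi> \<longlonglongrightarrow> \<zeta>" by (rule LIM_zero_cancel)
  then have "x = \<zeta>" using lim\<xi> LIMSEQ_unique by blast
  then have "T x = Some y" using \<zeta> by (auto simp: op_add_eq_Some b)
  then show "l \<in> Map.graph T" by (cases l) (simp add: x_def y_def in_graphI)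
qed

lemma dense_dom_T: "dense_wrt D N (dom T)"
proof (rule dense_wrt_if_annihilator_trivial[OF _ dom_T])
  show "csubspace (dom T)" using operator_T by (simp add: operator_def)
  fix f x assume f: "f \<in> dual D N" "\<forall>y\<in>dom T. f y = 0" and x: "x \<in> D"
  obtain \<beta> where "isomorphic_form D N (\<lambda>\<xi> \<eta>. \<Omega> \<xi> \<eta> + \<Upsilon> \<xi> \<eta>) \<beta>"
    by (rule isomorphic_form_perturbed[OF \<Upsilon>])
  then interpret iso: isomorphic_form D N "\<lambda>\<xi> \<eta>. \<Omega> \<xi> \<eta> + \<Upsilon> \<xi> \<eta>" \<beta> .
  obtain y where y: "y \<in> D" "\<And>x. x \<in> D \<Longrightarrow> f x = \<Omega> x y + \<Upsilon> x y"
    using iso.dual_represented[OF f(1)] by blast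
  \<comment> \<open>Surjectivity allows \<open>y\<close> to be tested against itself.\<close>
  obtain \<xi> where \<xi>: "op_add T B \<xi> = Some y" by (rule T_plus_B_surj)
  then have "\<xi> \<in> dom T" by (auto simp: op_add_eq_Some)
  then have "f \<xi> = 0" using f(2) by blast
  moreover have "f \<xi> = cinner y y" using \<xi> y unfolding T_plus_B_eq_Some by auto
  ultimately have "cinner y y = 0" by simp
  then have "y = 0" by (simp add: cinner_eq_zero_iff)
  then show "f x = 0" using y x iso.a_scale_right[OF x zero_mem, of 0] by simp
qed

text \<open>By maximality \<open>T'\<close> is a restriction of \<open>T\<close>. If T' + B is
  already onto, injectivity of T + B leaves no room for a larger domain.\<close>

lemma T_unique:
  assumes T': "operator T'" "dom T' \<subseteq> D" "represents_on T' \<Omega> D" "ran (op_add T' B) = UNIV"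
  shows "T' = T"
proof -
  have "dense_wrt D N D"
    using N_zero by (auto simp: dense_wrt_iff intro!: bexI)
  then have sub: "T' \<subseteq>\<^sub>m T" using T' by (intro T_maximal)
  have "T x = T' x" if x: "x \<in> dom T" for x
  proof -
    obtain b where b: "\<And>x. B x = Some (b x)" by (rule bounded_ops_total[OF B]) blast
    obtain w where w: "T x = Some w" using x by blast
    have "w + b x \<in> ran (op_add T' B)" using T'(4) by simp
    then obtain x' w' where x': "T' x' = Some w'" "w + b x = w' + b x'"
      by (auto simp: ran_def op_add_eq_Some b)
    then have "T x' = Some w'" using sub by (metis domI map_le_def)
    then have "op_add T B x = Some (w + b x)" "op_add T B x' = Some (w + b x)"
      using w x' by (auto simp: op_add_eq_Some b)
    then have "x = x'"
      using invertible_T_plus_B by (auto simp: op_invertible_def inj_on_def dom_def)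
    then show ?thesis using x'(1) \<open>T x' = Some w'\<close> by simp
  qed
  then have "T \<subseteq>\<^sub>m T'" by (simp add: map_le_def)
  with sub show ?thesis by (rule map_le_antisym)
qed

end

text \<open>Approximation for \<open>N\<close> is approximation in H because norm \<le> \<alpha> N,
  and \<open>D\<close> is dense in H.\<close>

lemma closure_dom_T:
  assumes "dense_wrt D N (dom T)"
  shows "closure (dom T) = UNIV"
proof -
  obtain \<alpha> where \<alpha>: "\<alpha> > 0" "\<And>\<xi>. \<xi> \<in> D \<Longrightarrow> norm \<xi> \<le> \<alpha> * N \<xi>"
    by (rule norm_le_N) blast
  have "x \<in> closure (dom T)" if x: "x \<in> D" for x
    unfolding closure_approachable
  proof (intro allI impI)
    fix e :: real assume "e > 0"
    then obtain y where y: "y \<in> dom T" "N (x - y) < e / \<alpha>"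
      using assms x \<alpha>(1) unfolding dense_wrt_iff by (meson divide_pos_pos)
    have "norm (x - y) \<le> \<alpha> * N (x - y)"
      using y(1) dom_T x by (intro \<alpha> diff_mem) auto
    also have "\<dots> < e" using y(2) \<alpha>(1) by (simp add: field_simps)
    finally show "\<exists>y\<in>dom T. dist y x < e" using y(1) by (auto simp: dist_norm norm_minus_commute)
  qed
  then have "closure D \<subseteq> closure (dom T)" by (intro closure_minimal) auto
  then show ?thesis using dense_D by auto
qed

end

theorem theorem4p6:
  fixes D :: "'a::complex_hilbert set"
    and \<Omega> :: "'a \<Rightarrow> 'a \<Rightarrow> complex"
    and N :: "'a \<Rightarrow> real"
  assumes "csubspace D" and "closure D = UNIV"
    and "sesquilinear_on D \<Omega>"
    and "norm_on D N"
    and "solvable D \<Omega> N"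
  shows "\<exists>T. closed_operator T \<and> dom T \<subseteq> D \<and> closure (dom T) = UNIV \<and> represents_on T \<Omega> D \<and>
    dense_wrt D N (dom T) \<and>
    (\<forall>T' S. operator T' \<and> dom T' \<subseteq> D \<and> dense_wrt D N S \<and> represents_on T' \<Omega> S
        \<longrightarrow> T' \<subseteq>\<^sub>m T) \<and>
    (\<forall>\<Upsilon>\<in>solving_forms D \<Omega> N. \<forall>B\<in>bounded_ops. represents_on B \<Upsilon> UNIV
        \<longrightarrow> op_invertible (op_add T B) \<and> op_inverse (op_add T B) \<in> bounded_ops) \<and>
    (\<forall>l. (\<lambda>\<xi> \<eta>. - l * cinner \<xi> \<eta>) \<in> solving_forms D \<Omega> N \<longrightarrow> l \<in> resolvent_set T) \<and>
    (\<forall>\<Upsilon>\<in>solving_forms D \<Omega> N. \<forall>B\<in>bounded_ops. represents_on B \<Upsilon> UNIV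
        \<longrightarrow> ran (op_add T B) = UNIV \<and>
            (\<forall>T'. operator T' \<and> dom T' \<subseteq> D \<and> represents_on T' \<Omega> D \<and> ran (op_add T' B) = UNIV
                \<longrightarrow> T' = T))"
proof -
  interpret solvable_form D \<Omega> N by unfold_locales fact+
  \<comment> \<open>An arbitrary solving form, through which closedness and density of the domain
    are proved; neither statement mentions it.\<close>
  obtain \<Upsilon>\<^sub>0 where \<Upsilon>\<^sub>0: "\<Upsilon>\<^sub>0 \<in> solving_forms D \<Omega> N"
    using solvable by (auto simp: solvable_def)
  then obtain B\<^sub>0 where B\<^sub>0: "B\<^sub>0 \<in> bounded_ops" "represents_on B\<^sub>0 \<Upsilon>\<^sub>0 UNIV"
    by (auto simp: solving_forms_def intro: bounded_form_represented)
  have dense: "dense_wrt D N (dom T)" by (rule dense_dom_T[OF \<Upsilon>\<^sub>0 B\<^sub>0])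
  have "l \<in> resolvent_set T" if "(\<lambda>\<xi> \<eta>. - l * cinner \<xi> \<eta>) \<in> solving_forms D \<Omega> N" for l
  proof -
    have "represents_on (op_scalar (- l)) (\<lambda>\<xi> \<eta>. - l * cinner \<xi> \<eta>) UNIV"
      unfolding represents_on_def op_scalar_def by (simp only: option.sel cinner_scaleC_left) simp
    then show ?thesis
      using invertible_T_plus_B[OF that op_scalar_bounded] inverse_T_plus_B[OF that op_scalar_bounded]
      unfolding resolvent_set_def by blast
  qed
  moreover have "closed_operator T"
    using operator_T closed_graph_T[OF \<Upsilon>\<^sub>0 B\<^sub>0] by (simp add: closed_operator_def)
  ultimately show ?thesis
    using dom_T represents_T dense closure_dom_T[OF dense] T_maximal invertible_T_plus_B
      inverse_T_plus_B ran_T_plus_B T_unique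
    by (intro exI[of _ T]) blast
qed

end
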